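(* Let $(\Omega,\mathcal{F},\mathsf{P})$ be atomless and let $u$ be a coherent utility on $L^0$ with determining set $\mathcal{D}$. The following are equivalent: (i) $u$ is law invariant; (ii) $\mathcal{D}$ is law invariant, i.e. if $Z\in\mathcal{D}$ and $Z'$ has the same distribution as $Z$ (as random variables under $\mathsf{P}$), then $Z'\in\mathcal{D}$; (iii) there exists a set $\mathfrak{M}$ of probability measures on $(0,1]$ such that $u(X)=\inf_{\mu\in\mathfrak{M}}u_\mu(X)$ for all $X\in L^0$; (iv) there exists a set $\mathfrak{M}$ of probability measures on $(0,1]$ such that $\mathcal{D}=\bigcup_{\mu\in\mathfrak{M}}\mathcal{D}_\mu$.
   Context: Let $(\Omega,\mathcal{F},\mathsf{P})$ be a probability space, $L^0$ the space of all real random variables, and $\mathcal{P}$ the set of probability measures on $\mathcal{F}$ absolutely continuous with respect to $\mathsf{P}$; measures are identified with their densities $Z=d\mathsf{Q}/d\mathsf{P}$. For $\mathsf{Q}\in\mathcal{P}$, $\mathsf{E}_\mathsf{Q}X:=\mathsf{E}_\mathsf{Q}X^+-\mathsf{E}_\mathsf{Q}X^-$ with the convention $\infty-\infty=-\infty$. A coherent utility on $L^0$ is a map $u:L^0\to[-\infty,\infty]$ of the form $u(X)=\inf_{\mathsf{Q}\in\mathcal{D}}\mathsf{E}_\mathsf{Q}X$ for a nonempty $\mathcal{D}\subseteq\mathcal{P}$; its determining set is the largest such set, $\{\mathsf{Q}\in\mathcal{P}:\mathsf{E}_\mathsf{Q}X\ge u(X)\ \forall X\in L^0\}$. $u$ is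 law invariant if $u(X)=u(X')$ whenever $X,X'$ have the same distribution. For $\lambda\in(0,1]$, $u_\lambda(X)=\inf\{\mathsf{E}_\mathsf{Q}X:\mathsf{Q}\in\mathcal{P},\ d\mathsf{Q}/d\mathsf{P}\le\lambda^{-1}\}$. For a probability measure $\mu$ on $(0,1]$, $u_\mu(X)=\int_{(0,1]}u_\lambda(X)\mu(d\lambda)$, $X\in L^0$, where $\int f\,d\mu:=\int f^+d\mu-\int f^-d\mu$ with $\infty-\infty=-\infty$; $u_\mu$ (Weighted V@R utility) is a coherent utility on $L^0$, and $\mathcal{D}_\mu$ denotes its determining set. *)

theory Defs
  imports "HOL-Probability.Probability"
begin

text \<open>The underlying probability space is a measure M with prob_space M.
  L^0 is represented by the real random variables X in borel_measurable M.
  A probability measure Q absolutely continuous w.r.t. P is identified with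
  its density Z = dQ/dP: a measurable, a.e. nonnegative function with
  integral one.\<close>

definition densities :: "'a measure \<Rightarrow> ('a \<Rightarrow> real) set" where
  "densities M = {Z. Z \<in> borel_measurable M \<and> (AE x in M. 0 \<le> Z x)
                     \<and> (\<integral>\<^sup>+ x. ennreal (Z x) \<partial>M) = 1}"

definition ediff :: "ennreal \<Rightarrow> ennreal \<Rightarrow> ereal" where
  "ediff a b = (if a = \<infinity> \<and> b = \<infinity> then - \<infinity>
                else enn2ereal a - enn2ereal b)"

definition EQ :: "'a measure \<Rightarrow> ('a \<Rightarrow> real) \<Rightarrow> ('a \<Rightarrow> real) \<Rightarrow> ereal" where
  "EQ M Z X = ediff (\<integral>\<^sup>+ x. ennreal (Z x) * ennreal (max (X x) 0) \<partial>M)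
                    (\<integral>\<^sup>+ x. ennreal (Z x) * ennreal (max (- X x) 0) \<partial>M)"

definition coherent_utility :: "'a measure \<Rightarrow> (('a \<Rightarrow> real) \<Rightarrow> ereal) \<Rightarrow> bool" where
  "coherent_utility M u \<longleftrightarrow>
     (\<exists>D. D \<noteq> {} \<and> D \<subseteq> densities M \<and>
          (\<forall>X \<in> borel_measurable M. u X = (INF Z\<in>D. EQ M Z X)))"

definition determining_set :: "'a measure \<Rightarrow> (('a \<Rightarrow> real) \<Rightarrow> ereal) \<Rightarrow> ('a \<Rightarrow> real) set" where
  "determining_set M u = {Z \<in> densities M. \<forall>X \<in> borel_measurable M. u X \<le> EQ M Z X}"

definition law_invariant_utility :: "'a measure \<Rightarrow> (('a \<Rightarrow> real) \<Rightarrow> ereal) \<Rightarrow> bool" where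
  "law_invariant_utility M u \<longleftrightarrow>
     (\<forall>X \<in> borel_measurable M. \<forall>X' \<in> borel_measurable M.
        distr M borel X = distr M borel X' \<longrightarrow> u X = u X')"

definition law_invariant_set :: "'a measure \<Rightarrow> ('a \<Rightarrow> real) set \<Rightarrow> bool" where
  "law_invariant_set M D \<longleftrightarrow>
     (\<forall>Z \<in> D. \<forall>Z' \<in> borel_measurable M.
        distr M borel Z' = distr M borel Z \<longrightarrow> Z' \<in> D)"

definition atomless :: "'a measure \<Rightarrow> bool" where
  "atomless M \<longleftrightarrow>
     (\<forall>A \<in> sets M. 0 < measure M A \<longrightarrow>
        (\<exists>B \<in> sets M. B \<subseteq> A \<and> 0 < measure M B \<and> measure M B < measure M A))"

definition u_lambda :: "'a measure \<Rightarrow> real \<Rightarrow> ('a \<Rightarrow> real) \<Rightarrow> ereal" where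
  "u_lambda M l X = (INF Z \<in> {Z \<in> densities M. AE x in M. Z x \<le> 1 / l}. EQ M Z X)"

definition prob_on_unit :: "real measure \<Rightarrow> bool" where
  "prob_on_unit \<mu> \<longleftrightarrow> prob_space \<mu> \<and> sets \<mu> = sets (restrict_space borel {0<..1})"

definition u_mu :: "'a measure \<Rightarrow> real measure \<Rightarrow> ('a \<Rightarrow> real) \<Rightarrow> ereal" where
  "u_mu M \<mu> X = ediff (\<integral>\<^sup>+ l. e2ennreal (u_lambda M l X) \<partial>\<mu>)
                      (\<integral>\<^sup>+ l. e2ennreal (- u_lambda M l X) \<partial>\<mu>)"

end

theory Submission
  imports Defs
begin

text \<open>On an atomless space every random variable \<open>X\<close> is ordered like a uniform variable \<open>U\<close>. Hence every
  density \<open>Z\<close> has a rearrangement \<open>q(1 - U)\<close>, with \<open>q\<close> the quantile function of \<open>Z\<close>, which is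
  antimonotone to \<open>X\<close> and, by the Hardy--Littlewood inequality, minimises \<open>E[Z' X]\<close> over all
  \<open>Z'\<close> with the law of \<open>Z\<close>. Rearranging either \<open>X\<close> or \<open>Z\<close> gives the equivalence of law invariance
  of the utility and of its determining set. The minimum is a mixture of the utilities \<open>u_\<lambda>(X)\<close>,
  because the decreasing function \<open>q(1 - s)\<close> is a mixture of the functions
  \<open>1{s < \<lambda>} / \<lambda>\<close>; so it equals \<open>u_\<mu>(X)\<close> for a measure \<open>\<mu>\<close> that depends only on the law
  of \<open>Z\<close>, and a law invariant determining set is the union of the sets \<open>D_\<mu>\<close> of its elements.\<close>

section \<open>Atomless spaces\<close>

text \<open>Of a proper subset of positive smaller measure and its relative complement, one has at
  most half the measure. Iterating this choice beats every positive bound.\<close>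

lemma (in prob_space) atomless_small_subset:
  assumes atomless: "atomless M" and A: "A \<in> events" "0 < prob A" and e: "0 < e"
  shows "\<exists>B\<in>events. B \<subseteq> A \<and> 0 < prob B \<and> prob B \<le> e"
proof -
  have halve: "\<exists>B\<in>events. B \<subseteq> A \<and> 0 < prob B \<and> prob B \<le> (1/2) ^ n" for n
  proof (induction n)
    case 0
    then show ?case using A by (intro bexI[of _ A]) auto
  next
    case (Suc n)
    then obtain B where B: "B \<in> events" "B \<subseteq> A" "0 < prob B" "prob B \<le> (1/2) ^ n" by auto
    obtain C where C: "C \<in> events" "C \<subseteq> B" "0 < prob C" "prob C < prob B"
      using atomless B unfolding atomless_def by blast
    have diff: "prob (B - C) = prob B - prob C"
      using B C by (intro finite_measure_Diff) auto
    show ?case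
    proof (cases "prob C \<le> prob B / 2")
      case True
      then show ?thesis using B C by (intro bexI[of _ C]) auto
    next
      case False
      then show ?thesis using B C diff by (intro bexI[of _ "B - C"]) auto
    qed
  qed
  obtain n where "(1/2) ^ n < e"
    using real_arch_pow_inv[OF e, of "1/2"] by auto
  with halve[of n] show ?thesis by (meson less_imp_le order_trans)
qed

text \<open>Sierpinski's theorem. The sets are enlarged greedily: each step gains at least half of what
  can still be gained below the target measure.\<close>

lemma (in prob_space) atomless_subset_prob:
  assumes atomless: "atomless M" and A: "A \<in> events" and c: "0 \<le> c" "c \<le> prob A"
  shows "\<exists>B\<in>events. B \<subseteq> A \<and> prob B = c"
proof -
  define F where "F B = {C \<in> events. B \<subseteq> C \<and> C \<subseteq> A \<and> prob C \<le> c}" for B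
  define S where "S B = (SUP C\<in>F B. prob C)" for B
  have bdd: "bdd_above (prob ` F B)" for B by (auto intro: bdd_aboveI[of _ 1])
  have S_ge: "prob C \<le> S B" if "C \<in> F B" for B C
    unfolding S_def by (rule cSUP_upper[OF that bdd])
  have "\<exists>f. \<forall>n. f n \<in> F {} \<and> (f (Suc n) \<in> F (f n) \<and> (prob (f n) + S (f n)) / 2 \<le> prob (f (Suc n)))"
  proof (rule dependent_nat_choice)
    show "\<exists>B. B \<in> F {}" using c by (intro exI[of _ "{}"]) (auto simp: F_def)
    fix B :: "'a set" assume B: "B \<in> F {}"
    then have BB: "B \<in> F B" by (auto simp: F_def)
    show "\<exists>C. C \<in> F {} \<and> C \<in> F B \<and> (prob B + S B) / 2 \<le> prob C"
    proof (cases "prob B = S B")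
      case True
      then show ?thesis using B BB by auto
    next
      case False
      then have "(prob B + S B) / 2 < S B" using S_ge[OF BB] by auto
      then obtain C where "C \<in> F B" "(prob B + S B) / 2 < prob C"
        unfolding S_def using BB bdd[of B] by (subst (asm) less_cSUP_iff) auto
      then show ?thesis by (intro exI[of _ C]) (auto simp: F_def)
    qed
  qed
  then obtain f where f: "\<And>n. f n \<in> F {}" "\<And>n. f (Suc n) \<in> F (f n)"
    "\<And>n. (prob (f n) + S (f n)) / 2 \<le> prob (f (Suc n))" by blast
  define B where "B = (\<Union>n. f n)"
  have inc: "incseq f" using f(2) by (intro incseq_SucI) (auto simp: F_def)
  have lim: "(\<lambda>n. prob (f n)) \<longlonglongrightarrow> prob B"
    unfolding B_def using f(1) inc by (intro finite_Lim_measure_incseq) (auto simp: F_def)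
  have B: "B \<in> events" "B \<subseteq> A" unfolding B_def using f(1) by (auto simp: F_def)
  have "prob B \<le> c" using f(1) by (intro LIMSEQ_le_const2[OF lim]) (auto simp: F_def)
  moreover have "\<not> prob B < c"
  proof
    assume less: "prob B < c"
    have "prob (A - B) = prob A - prob B" using A B by (intro finite_measure_Diff) auto
    then obtain D where D: "D \<in> events" "D \<subseteq> A - B" "0 < prob D" "prob D \<le> c - prob B"
      using atomless_small_subset[OF atomless, of "A - B" "c - prob B"] less c A B by auto
    have BD: "prob (B \<union> D) = prob B + prob D" using B D by (intro finite_measure_Union) auto
    \<comment> \<open>\<open>B \<union> D\<close> is an admissible enlargement of every
      \<open>f n\<close>, so the greedy rule forces \<open>f (Suc n)\<close> to account for at least
      half of that gain. In the limit the bound becomes \<open>prob B\<close>, which contradicts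
      \<open>0 < prob D\<close>.\<close>
    have "prob (B \<union> D) \<le> 2 * prob (f (Suc n)) - prob (f n)" for n
    proof -
      have "B \<union> D \<in> F (f n)" using B D BD by (auto simp: F_def B_def)
      from S_ge[OF this] f(3)[of n] show ?thesis by simp
    qed
    moreover have "(\<lambda>n. 2 * prob (f (Suc n)) - prob (f n)) \<longlonglongrightarrow> 2 * prob B - prob B"
      by (intro tendsto_intros lim LIMSEQ_Suc)
    ultimately have "prob (B \<union> D) \<le> 2 * prob B - prob B" by (intro LIMSEQ_le_const) auto
    with BD D show False by simp
  qed
  ultimately show ?thesis using B by (intro bexI[of _ B]) auto
qed

text \<open>Repeated halving of cells gives a binary expansion: \<open>k n x\<close> is the number
  of the level \<open>n\<close> cell of \<open>x\<close>, and \<open>V\<close> is the limit of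
  \<open>k n x / 2 ^ n\<close>. Every level set of \<open>V\<close> lies in two cells of measure at
  most \<open>(1/2) ^ n\<close>, for every \<open>n\<close>.\<close>

lemma (in prob_space) atomless_continuous_variable:
  assumes atomless: "atomless M"
  shows "\<exists>V\<in>borel_measurable M. (\<forall>x. 0 \<le> V x \<and> V x \<le> (1::real)) \<and> (\<forall>v. prob {x \<in> space M. V x = v} = 0)"
proof -
  define P where "P n k \<longleftrightarrow> k \<in> measurable M (count_space UNIV) \<and> (\<forall>x. k x < 2 ^ n)
      \<and> (\<forall>i. prob {x \<in> space M. k x = i} \<le> (1/2) ^ n)" for n and k :: "'a \<Rightarrow> nat"
  have "\<exists>k. \<forall>n. P n (k n) \<and> (\<forall>x. k (Suc n) x = 2 * k n x \<or> k (Suc n) x = 2 * k n x + 1)"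
  proof (rule dependent_nat_choice)
    show "\<exists>k. P 0 k" by (intro exI[of _ "\<lambda>_. 0"]) (auto simp: P_def)
    fix k n assume k: "P n k"
    then have [measurable]: "k \<in> measurable M (count_space UNIV)" by (simp add: P_def)
    have "\<exists>B\<in>events. B \<subseteq> {x \<in> space M. k x = i} \<and> prob B = prob {x \<in> space M. k x = i} / 2" for i
      by (intro atomless_subset_prob[OF atomless]) auto
    then obtain B where B: "\<And>i. B i \<in> events" "\<And>i. B i \<subseteq> {x \<in> space M. k x = i}"
      "\<And>i. prob (B i) = prob {x \<in> space M. k x = i} / 2" by metis
    \<comment> \<open>Cell \<open>i\<close> splits into the cells \<open>2 * i\<close> and
      \<open>2 * i + 1\<close>; the odd one is the chosen half \<open>B i\<close>.\<close>
    define k' where "k' x = 2 * k x + (if x \<in> (\<Union>i. B i) then 1 else 0)" for x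
    have [measurable]: "(\<Union>i. B i) \<in> events" using B by auto
    have [measurable]: "k' \<in> measurable M (count_space UNIV)" unfolding k'_def by measurable
    have bound: "prob {x \<in> space M. k' x = i} \<le> (1/2) ^ Suc n" for i
    proof -
      have half: "prob {x \<in> space M. k x = i div 2} / 2 \<le> (1/2) ^ Suc n"
        using k by (simp add: P_def)
      show ?thesis
      proof (cases "even i")
        case True
        then have "{x \<in> space M. k' x = i} \<subseteq> {x \<in> space M. k x = i div 2} - B (i div 2)"
          by (auto simp: k'_def split: if_splits)
        then have "prob {x \<in> space M. k' x = i} \<le> prob ({x \<in> space M. k x = i div 2} - B (i div 2))"
          using B(1) by (intro finite_measure_mono) auto
        also have "\<dots> = prob {x \<in> space M. k x = i div 2} - prob (B (i div 2))"
          using B by (intro finite_measure_Diff) auto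
        finally show ?thesis using half B(3)[of "i div 2"] by simp
      next
        case False
        have "{x \<in> space M. k' x = i} \<subseteq> B (i div 2)"
        proof
          fix x assume x: "x \<in> {x \<in> space M. k' x = i}"
          with False obtain j where j: "x \<in> B j" by (auto simp: k'_def split: if_splits)
          with B(2)[of j] have "k x = j" by auto
          with x j have "i div 2 = j" by (auto simp: k'_def split: if_splits)
          with j show "x \<in> B (i div 2)" by simp
        qed
        then have "prob {x \<in> space M. k' x = i} \<le> prob (B (i div 2))"
          using B(1) by (intro finite_measure_mono) auto
        with half B(3)[of "i div 2"] show ?thesis by simp
      qed
    qed
    have lt: "k' x < 2 ^ Suc n" for x
    proof -
      have "k x < 2 ^ n" using k by (simp add: P_def)
      then show ?thesis by (auto simp: k'_def)
    qed
    show "\<exists>k'. P (Suc n) k' \<and> (\<forall>x. k' x = 2 * k x \<or> k' x = 2 * k x + 1)"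
      using bound lt by (intro exI[of _ k']) (auto simp: P_def k'_def)
  qed
  then obtain k where k: "\<And>n. P n (k n)"
    "\<And>n x. k (Suc n) x = 2 * k n x \<or> k (Suc n) x = 2 * k n x + 1" by blast
  have [measurable]: "k n \<in> measurable M (count_space UNIV)" for n using k(1) by (simp add: P_def)
  define V where "V x = (SUP n. real (k n x) / 2 ^ n)" for x
  have step: "real (k n x) / 2 ^ n \<le> real (k (Suc n) x) / 2 ^ Suc n"
    "(real (k (Suc n) x) + 1) / 2 ^ Suc n \<le> (real (k n x) + 1) / 2 ^ n" for n x
    using k(2)[of n x] by (auto simp: field_simps)
  have inc: "real (k n x) / 2 ^ n \<le> real (k m x) / 2 ^ m" if "n \<le> m" for n m x
    using that by (rule lift_Suc_mono_le[where f = "\<lambda>n. real (k n x) / 2 ^ n", OF step(1)])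
  have dec: "(real (k m x) + 1) / 2 ^ m \<le> (real (k n x) + 1) / 2 ^ n" if "n \<le> m" for n m x
    using that by (rule lift_Suc_antimono_le[where f = "\<lambda>n. (real (k n x) + 1) / 2 ^ n", OF step(2)])
  have le: "real (k m x) / 2 ^ m \<le> (real (k n x) + 1) / 2 ^ n" for n m x
  proof -
    have "real (k m x) / 2 ^ m \<le> real (k (max m n) x) / 2 ^ max m n" by (rule inc) simp
    also have "\<dots> \<le> (real (k (max m n) x) + 1) / 2 ^ max m n" by (simp add: divide_right_mono)
    also have "\<dots> \<le> (real (k n x) + 1) / 2 ^ n" by (rule dec) simp
    finally show ?thesis .
  qed
  have bdd: "bdd_above (range (\<lambda>n. real (k n x) / 2 ^ n))" for x
    using le[of _ x 0] by (intro bdd_aboveI) auto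
  have V_ge: "real (k n x) / 2 ^ n \<le> V x" for n x
    unfolding V_def by (rule cSUP_upper[OF _ bdd]) simp
  have V_le: "V x \<le> (real (k n x) + 1) / 2 ^ n" for n x
    unfolding V_def using le by (intro cSUP_least) auto
  have k0: "k 0 x = 0" for x using k(1)[of 0] by (simp add: P_def)
  have [measurable]: "V \<in> borel_measurable M"
    unfolding V_def using bdd by (intro borel_measurable_cSUP) auto
  have null: "prob {x \<in> space M. V x = v} = 0" for v
  proof -
    have "prob {x \<in> space M. V x = v} \<le> 2 * (1/2) ^ n" for n
    proof -
      \<comment> \<open>The dyadic intervals are closed at both ends, so a grid point
        \<open>v\<close> may come from either neighbouring cell. For \<open>i = 0\<close> the
        truncated \<open>i - 1\<close> merely repeats cell \<open>0\<close>.\<close>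
      define i where "i = nat \<lfloor>v * 2 ^ n\<rfloor>"
      have "k n x = i \<or> k n x = i - 1" if "V x = v" for x
      proof -
        have "real (k n x) \<le> v * 2 ^ n" "v * 2 ^ n \<le> real (k n x) + 1"
          using V_ge[of n x] V_le[of x n] that by (auto simp: field_simps)
        then have "int (k n x) \<le> \<lfloor>v * 2 ^ n\<rfloor>" "\<lfloor>v * 2 ^ n\<rfloor> \<le> int (k n x) + 1"
          by linarith+
        then show ?thesis unfolding i_def by linarith
      qed
      then have "{x \<in> space M. V x = v} \<subseteq> {x \<in> space M. k n x = i} \<union> {x \<in> space M. k n x = i - 1}"
        by auto
      then have "prob {x \<in> space M. V x = v} \<le> prob ({x \<in> space M. k n x = i} \<union> {x \<in> space M. k n x = i - 1})"
        by (intro finite_measure_mono) auto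
      also have "\<dots> \<le> prob {x \<in> space M. k n x = i} + prob {x \<in> space M. k n x = i - 1}"
        by (intro measure_Un_le) auto
      also have "\<dots> \<le> (1/2) ^ n + (1/2) ^ n" using k(1)[of n] by (intro add_mono) (auto simp: P_def)
      finally show ?thesis by simp
    qed
    moreover have "(\<lambda>n. 2 * (1/2::real) ^ n) \<longlonglongrightarrow> 2 * 0"
      by (intro tendsto_intros LIMSEQ_power_zero) auto
    ultimately have "prob {x \<in> space M. V x = v} \<le> 2 * 0"
      by (intro LIMSEQ_le_const[where X = "\<lambda>n. 2 * (1/2) ^ n"]) auto
    then show ?thesis by (simp add: measure_le_0_iff)
  qed
  show ?thesis
  proof (intro bexI[of _ V] conjI allI)
    fix x show "0 \<le> V x" "V x \<le> 1" using V_ge[of 0 x] V_le[of x 0] k0 by auto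
  qed (use null in auto)
qed

section \<open>Uniform variables and quantiles\<close>

text \<open>Uniformity on the unit interval is expressed through the distribution function only;
  values outside the interval remain possible on a null set.\<close>

definition uniform_var :: "'a measure \<Rightarrow> ('a \<Rightarrow> real) \<Rightarrow> bool" where
  "uniform_var M U \<longleftrightarrow> U \<in> borel_measurable M \<and> (\<forall>r\<in>{0..1}. measure M {x \<in> space M. U x \<le> r} = r)"

lemma uniform_var_measurable: "uniform_var M U \<Longrightarrow> U \<in> borel_measurable M"
  by (simp add: uniform_var_def)

lemma uniform_varD: "uniform_var M U \<Longrightarrow> 0 \<le> r \<Longrightarrow> r \<le> 1 \<Longrightarrow> measure M {x \<in> space M. U x \<le> r} = r"
  by (simp add: uniform_var_def)

lemma (in prob_space) uniform_var_AE_neq: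
  assumes U: "uniform_var M U"
  shows "AE x in M. U x \<noteq> r"
proof -
  note [measurable] = uniform_var_measurable[OF U]
  have "prob {x \<in> space M. U x = r} \<le> 0"
  proof (cases "0 < r \<and> r \<le> 1")
    case True
    show ?thesis
    proof (rule field_le_epsilon)
      fix e :: real assume e: "0 < e"
      \<comment> \<open>The maximum keeps \<open>s\<close> in the range where the distribution
        function of \<open>U\<close> is prescribed.\<close>
      define s where "s = max 0 (r - e)"
      have s: "0 \<le> s" "s < r" "r \<le> s + e" using True e by (auto simp: s_def)
      have "prob {x \<in> space M. U x = r} \<le> prob ({x \<in> space M. U x \<le> r} - {x \<in> space M. U x \<le> s})"
        using s by (intro finite_measure_mono) auto
      also have "\<dots> = r - s"
        using True s uniform_varD[OF U, of r] uniform_varD[OF U, of s]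
        by (subst finite_measure_Diff) auto
      finally show "prob {x \<in> space M. U x = r} \<le> 0 + e" using s by simp
    qed
  next
    case False
    show ?thesis
    proof (cases "r \<le> 0")
      case True
      then have "prob {x \<in> space M. U x = r} \<le> prob {x \<in> space M. U x \<le> 0}"
        by (intro finite_measure_mono) auto
      then show ?thesis using uniform_varD[OF U, of 0] by simp
    next
      case r: False
      have "prob {x \<in> space M. U x = r} \<le> prob (space M - {x \<in> space M. U x \<le> 1})"
        using r False by (intro finite_measure_mono) auto
      also have "\<dots> = 0" using uniform_varD[OF U, of 1] by (subst prob_compl) auto
      finally show ?thesis .
    qed
  qed
  then have "prob {x \<in> space M. U x = r} = 0" by (simp add: measure_le_0_iff)
  then have "AE x in M. x \<notin> {x \<in> space M. U x = r}" by (subst (asm) prob_eq_0) auto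
  with AE_space show ?thesis by eventually_elim auto
qed

lemma (in prob_space) uniform_var_AE_Ioo:
  assumes U: "uniform_var M U"
  shows "AE x in M. 0 < U x \<and> U x < 1"
proof -
  note [measurable] = uniform_var_measurable[OF U]
  have "prob {x \<in> space M. U x \<le> 0} = 0" "prob {x \<in> space M. U x \<le> 1} = 1"
    using uniform_varD[OF U] by auto
  then have "AE x in M. x \<notin> {x \<in> space M. U x \<le> 0}" "AE x in M. x \<in> {x \<in> space M. U x \<le> 1}"
    by - (rule iffD1[OF prob_eq_0] iffD1[OF prob_eq_1]; simp)+
  then show ?thesis using uniform_var_AE_neq[OF U, of 1] AE_space by eventually_elim auto
qed

lemma (in prob_space) uniform_var_flip:
  assumes U: "uniform_var M U"
  shows "uniform_var M (\<lambda>x. 1 - U x)"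
  unfolding uniform_var_def
proof (intro conjI ballI)
  note [measurable] = uniform_var_measurable[OF U]
  show "(\<lambda>x. 1 - U x) \<in> borel_measurable M" by measurable
  fix r :: real assume r: "r \<in> {0..1}"
  have "prob {x \<in> space M. 1 - U x \<le> r} = prob (space M - {x \<in> space M. U x \<le> 1 - r})"
    using uniform_var_AE_neq[OF U, of "1 - r"] by (intro finite_measure_eq_AE) auto
  also have "\<dots> = r" using r uniform_varD[OF U, of "1 - r"] by (subst prob_compl) auto
  finally show "prob {x \<in> space M. 1 - U x \<le> r} = r" .
qed

lemma (in prob_space) cdf_distr_eq:
  "X \<in> borel_measurable M \<Longrightarrow> cdf (distr M borel X) t = prob {x \<in> space M. X x \<le> t}"
  unfolding cdf_def by (subst measure_distr) (auto intro!: arg_cong[where f = prob])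

text \<open>Probability integral transform. The law of \<open>W\<close> is the image of Lebesgue
  measure on the open unit interval under the pseudoinverse \<open>N.I\<close>, and absence of point
  masses makes the distribution function a left inverse of that map.\<close>

lemma (in prob_space) uniform_var_cdf:
  assumes [measurable]: "W \<in> borel_measurable M" and null: "\<And>w. prob {x \<in> space M. W x = w} = 0"
  shows "uniform_var M (\<lambda>x. cdf (distr M borel W) (W x))"
proof -
  define N where "N = distr M borel W"
  interpret N: cdf_distribution N
    unfolding N_def cdf_distribution_def by simp
  have cont: "isCont (cdf N) w" for w
  proof -
    have "W -` {w} \<inter> space M = {x \<in> space M. W x = w}" by auto
    then have "measure N {w} = prob {x \<in> space M. W x = w}"
      unfolding N_def by (simp add: measure_distr)
    then show ?thesis by (simp only: N.isCont_cdf null)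
  qed
  have inv: "cdf N (N.I s) = s" if s: "0 < s" "s < 1" for s
  proof (rule antisym)
    show "s \<le> cdf N (N.I s)" by (rule iffD2[OF N.pseudoinverse[OF s] order_refl])
    \<comment> \<open>If the value exceeded \<open>s\<close>, continuity would keep it above
      \<open>s\<close> slightly to the left of \<open>N.I s\<close>, although \<open>N.I s\<close>
      is the least point where level \<open>s\<close> is reached.\<close>
    show "cdf N (N.I s) \<le> s"
    proof (rule ccontr)
      assume "\<not> ?thesis"
      moreover have "(cdf N \<longlongrightarrow> cdf N (N.I s)) (at_left (N.I s))"
        using cont[of "N.I s"] unfolding isCont_def by (rule filterlim_mono) (auto intro: at_le)
      ultimately have "eventually (\<lambda>y. s < cdf N y) (at_left (N.I s))"
        by (intro order_tendstoD(1)) auto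
      moreover have "eventually (\<lambda>y. y < N.I s) (at_left (N.I s))"
        by (auto simp: eventually_at_filter)
      ultimately have "eventually (\<lambda>y. False) (at_left (N.I s))"
      proof eventually_elim
        case (elim y)
        then have "N.I s \<le> y" by (intro iffD1[OF N.pseudoinverse[OF s]]) simp
        with elim show ?case by simp
      qed
      then show False by simp
    qed
  qed
  let ?L = "restrict_space lborel {0<..<1::real}"
  have [measurable]: "N.I \<in> borel_measurable ?L"
    using N.measurable_CI by (simp cong: measurable_cong_sets add: sets_restrict_space)
  have "prob {x \<in> space M. cdf N (W x) \<le> r} = r" if r: "0 \<le> r" "r \<le> 1" for r
  proof -
    have "prob {x \<in> space M. cdf N (W x) \<le> r} = measure N {w. cdf N w \<le> r}"
      by (subst (2) N_def, subst measure_distr) (auto intro!: arg_cong[where f = prob])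
    also have "\<dots> = measure (distr ?L borel N.I) {w. cdf N w \<le> r}"
      by (simp add: N.distr_I_eq_M)
    also have "\<dots> = measure ?L {s \<in> {0<..<1}. cdf N (N.I s) \<le> r}"
      by (subst measure_distr) (auto simp: space_restrict_space intro!: arg_cong[where f = "measure ?L"])
    also have "\<dots> = measure lborel {s \<in> {0<..<1}. cdf N (N.I s) \<le> r}"
      by (subst measure_restrict_space) auto
    also have "{s \<in> {0<..<1}. cdf N (N.I s) \<le> r} = (if r < 1 then {0<..r} else {0<..<1})"
      using r inv by auto
    also have "measure lborel \<dots> = r" using r by auto
    finally show ?thesis .
  qed
  then show ?thesis unfolding uniform_var_def N_def[symmetric] by simp
qed

text \<open>Ties of \<open>X\<close> are broken by a variable \<open>V\<close> with continuous law: the variable \<open>W\<close> below again has a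
  continuous law, and \<open>X\<close> is a nondecreasing function of it.\<close>

lemma (in prob_space) atomless_uniform_order:
  assumes atomless: "atomless M" and X[measurable]: "X \<in> borel_measurable M"
  shows "\<exists>U. uniform_var M U \<and> (\<forall>t. AE x in M. X x \<le> t \<longleftrightarrow> U x \<le> cdf (distr M borel X) t)"
proof -
  obtain V where V[measurable]: "V \<in> borel_measurable M" and V': "\<forall>x. 0 \<le> V x \<and> V x \<le> (1::real)"
    and Vnull': "\<forall>v. prob {x \<in> space M. V x = v} = 0"
    using atomless_continuous_variable[OF atomless] by (elim bexE conjE)
  have V01: "0 \<le> V x" "V x \<le> 1" for x using V' by auto
  have Vnull: "prob {x \<in> space M. V x = v} = 0" for v using Vnull' by auto
  define F where "F z = prob {x \<in> space M. X x \<le> z}" for z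
  define G where "G z = prob {x \<in> space M. X x < z}" for z
  have F_mono: "F z \<le> F z'" if "z \<le> z'" for z z'
    unfolding F_def using that by (intro finite_measure_mono) auto
  have G_mono: "G z \<le> G z'" if "z \<le> z'" for z z'
    unfolding G_def using that by (intro finite_measure_mono) auto
  have FG: "F z \<le> G z'" if "z < z'" for z z'
    unfolding F_def G_def using that by (intro finite_measure_mono) auto
  have GF: "G z \<le> F z" for z
    unfolding F_def G_def by (intro finite_measure_mono) auto
  have gap: "F z - G z = prob {x \<in> space M. X x = z}" for z
    unfolding F_def G_def
    by (subst finite_measure_Diff[symmetric]) (auto intro!: arg_cong[where f = prob])
  have [measurable]: "F \<in> borel_measurable borel" "G \<in> borel_measurable borel"
    by (auto intro!: borel_measurable_mono monoI F_mono G_mono)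
  \<comment> \<open>At an atom \<open>z\<close> of \<open>X\<close>, the variable \<open>V\<close>
    spreads the value over the interval from \<open>z + G z\<close> to \<open>z + F z\<close>. The
    summand \<open>X x\<close> makes \<open>W\<close> strictly larger whenever \<open>X\<close> is,
    even between points with \<open>F z = G z'\<close>.\<close>
  define W where "W x = X x + G (X x) + V x * (F (X x) - G (X x))" for x
  have [measurable]: "W \<in> borel_measurable M" unfolding W_def by measurable
  have W_bounds: "X x + G (X x) \<le> W x" "W x \<le> X x + F (X x)" for x
  proof -
    show "X x + G (X x) \<le> W x" using V01[of x] GF[of "X x"] by (simp add: W_def)
    have "V x * (F (X x) - G (X x)) \<le> 1 * (F (X x) - G (X x))"
      using V01[of x] GF[of "X x"] by (intro mult_right_mono) auto
    then show "W x \<le> X x + F (X x)" by (simp add: W_def)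
  qed
  have W_less: "W x < W y" if "X x < X y" for x y
    using W_bounds(2)[of x] W_bounds(1)[of y] FG[OF that] that by linarith
  have Wnull: "prob {x \<in> space M. W x = w} = 0" for w
  proof (cases "\<exists>x\<in>space M. W x = w")
    case True
    then obtain x0 where x0: "x0 \<in> space M" "W x0 = w" by auto
    define z where "z = X x0"
    \<comment> \<open>A level set of \<open>W\<close> lies in a single level set of
      \<open>X\<close>. Either that set is null, or \<open>W\<close> is there a nonconstant affine
      function of \<open>V\<close>, whose level sets are null.\<close>
    have z: "X x = z" if "W x = w" for x
      using W_less[of x x0] W_less[of x0 x] that x0 unfolding z_def by (cases "X x" "X x0" rule: linorder_cases) auto
    show ?thesis
    proof (cases "F z = G z")
      case True
      then have "prob {x \<in> space M. X x = z} = 0" using gap[of z] by simp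
      moreover have "prob {x \<in> space M. W x = w} \<le> prob {x \<in> space M. X x = z}"
        using z by (intro finite_measure_mono) auto
      ultimately show ?thesis by (simp add: measure_le_0_iff)
    next
      case False
      have "prob {x \<in> space M. W x = w} \<le> prob {x \<in> space M. V x = (w - z - G z) / (F z - G z)}"
      proof (intro finite_measure_mono subsetI)
        fix x assume x: "x \<in> {x \<in> space M. W x = w}"
        then have "W x = w" "X x = z" using z[of x] by auto
        then have "V x * (F z - G z) = w - z - G z" unfolding W_def by auto
        with False have "V x = (w - z - G z) / (F z - G z)" by (simp add: eq_divide_eq)
        with x show "x \<in> {x \<in> space M. V x = (w - z - G z) / (F z - G z)}" by simp
      qed auto
      then show ?thesis by (simp only: Vnull measure_le_0_iff)
    qed
  next
    case False
    then have "{x \<in> space M. W x = w} = {}" by auto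
    then show ?thesis by (simp only: measure_empty)
  qed
  define U where "U x = cdf (distr M borel W) (W x)" for x
  have U: "uniform_var M U" unfolding U_def by (rule uniform_var_cdf) (auto simp: Wnull)
  have U_eq: "U x = prob {y \<in> space M. W y \<le> W x}" for x unfolding U_def by (rule cdf_distr_eq) simp
  \<comment> \<open>For \<open>t < X x\<close> the comparison yields only the weak inequality
    \<open>F t \<le> U x\<close>; discarding the null event \<open>U x = F t\<close> makes it
    strict.\<close>
  have "AE x in M. X x \<le> t \<longleftrightarrow> U x \<le> cdf (distr M borel X) t" for t
    using uniform_var_AE_neq[OF U, of "F t"] AE_space
  proof eventually_elim
    case (elim x)
    have 1: "U x \<le> F t" if "X x \<le> t"
      unfolding U_eq F_def
    proof (intro finite_measure_mono subsetI)
      fix y assume "y \<in> {y \<in> space M. W y \<le> W x}"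
      then show "y \<in> {x \<in> space M. X x \<le> t}" using W_less[of x y] that by force
    qed auto
    have 2: "F t \<le> U x" if "t < X x"
      unfolding U_eq F_def
    proof (intro finite_measure_mono subsetI)
      fix y assume "y \<in> {x \<in> space M. X x \<le> t}"
      then show "y \<in> {y \<in> space M. W y \<le> W x}" using W_less[of y x] that by auto
    qed auto
    have "cdf (distr M borel X) t = F t" unfolding F_def by (rule cdf_distr_eq) simp
    with 1 2 elim show ?case by (cases "X x \<le> t") auto
  qed
  with U show ?thesis by blast
qed

text \<open>The lower generalised inverse of the distribution function. At levels outside the open
  unit interval the infimum may run over an empty or unbounded set, so the default value
  \<open>0\<close> is used.\<close>

definition quantile :: "real measure \<Rightarrow> real \<Rightarrow> real" where
  "quantile N r = (if 0 < r \<and> r < 1 then Inf {x. r \<le> cdf N x} else 0)"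

lemma quantile_le_iff:
  assumes "real_distribution N" "0 < r" "r < 1"
  shows "quantile N r \<le> x \<longleftrightarrow> r \<le> cdf N x"
proof -
  interpret cdf_distribution N using assms(1) by (simp add: cdf_distribution_def)
  show ?thesis using pseudoinverse[of r x] assms by (simp add: quantile_def)
qed

lemma measurable_quantile:
  assumes "real_distribution N"
  shows "quantile N \<in> borel_measurable borel"
proof -
  interpret cdf_distribution N using assms(1) by (simp add: cdf_distribution_def)
  have "(\<lambda>r. if r \<in> {0<..<1} then I r else 0) \<in> borel_measurable borel"
    using measurable_CI by (subst measurable_If_restrict_space_iff) (simp_all del: greaterThanLessThan_iff)
  then show ?thesis by (simp add: quantile_def[abs_def])
qed

text \<open>Inverse transform: \<open>quantile_le_iff\<close> turns the event that the quantile is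
  at most \<open>t\<close> into \<open>U x \<le> cdf N t\<close>, whose probability is
  \<open>cdf N t\<close>.\<close>

lemma (in prob_space) distr_quantile:
  assumes N: "real_distribution N" and U: "uniform_var M U"
  shows "distr M borel (\<lambda>x. quantile N (U x)) = N"
proof (rule cdf_unique)
  interpret N: real_distribution N by fact
  note [measurable] = measurable_quantile[OF N] uniform_var_measurable[OF U]
  show "real_distribution (distr M borel (\<lambda>x. quantile N (U x)))" by simp
  show "cdf (distr M borel (\<lambda>x. quantile N (U x))) = cdf N"
  proof
    fix t
    have "cdf (distr M borel (\<lambda>x. quantile N (U x))) t = prob {x \<in> space M. quantile N (U x) \<le> t}"
      by (rule cdf_distr_eq) simp
    also have "\<dots> = prob {x \<in> space M. U x \<le> cdf N t}"
      using uniform_var_AE_Ioo[OF U] quantile_le_iff[OF N] by (intro finite_measure_eq_AE) auto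
    also have "\<dots> = cdf N t"
      by (rule uniform_varD[OF U]) (auto simp: N.cdf_nonneg N.cdf_bounded_prob)
    finally show "cdf (distr M borel (\<lambda>x. quantile N (U x))) t = cdf N t" .
  qed
qed fact

section \<open>Antimonotone rearrangements\<close>

text \<open>The truncated value \<open>ennreal (h x)\<close> is the length of the set of levels
  between \<open>0\<close> and \<open>h x\<close>; Tonelli swaps the integrals. The strict form
  suits upper tails of a variable, the weak form its closed lower tails, which arise from negative
  parts.\<close>

lemma (in sigma_finite_measure) nn_integral_layer_cake:
  fixes h :: "'a \<Rightarrow> real"
  assumes [measurable]: "h \<in> borel_measurable M" "w \<in> borel_measurable M"
  shows "(\<integral>\<^sup>+x. ennreal (h x) * w x \<partial>M)
       = (\<integral>\<^sup>+t. indicator {0<..} t * (\<integral>\<^sup>+x. indicator {t<..} (h x) * w x \<partial>M) \<partial>lborel)"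
    and nn_integral_layer_cake_weak: "(\<integral>\<^sup>+x. ennreal (h x) * w x \<partial>M)
       = (\<integral>\<^sup>+t. indicator {0<..} t * (\<integral>\<^sup>+x. indicator {t..} (h x) * w x \<partial>M) \<partial>lborel)"
proof -
  interpret P: pair_sigma_finite M lborel by standard
  have ind: "indicator {t<..} y = (if t < y then 1 else 0::ennreal)"
    "indicator {t..} y = (if t \<le> y then 1 else 0::ennreal)" for t y :: real
    by (auto simp: indicator_def)
  have "(\<integral>\<^sup>+t. indicator {0<..} t * (\<integral>\<^sup>+x. indicator {t<..} (h x) * w x \<partial>M) \<partial>lborel)
      = (\<integral>\<^sup>+t. (\<integral>\<^sup>+x. indicator {0<..} t * (indicator {t<..} (h x) * w x) \<partial>M) \<partial>lborel)"
    unfolding ind by (intro nn_integral_cong nn_integral_cmult[symmetric]) measurable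
  also have "\<dots> = (\<integral>\<^sup>+x. (\<integral>\<^sup>+t. indicator {0<..} t * (indicator {t<..} (h x) * w x) \<partial>lborel) \<partial>M)"
    unfolding ind by (rule P.Fubini') measurable
  also have "\<dots> = (\<integral>\<^sup>+x. (\<integral>\<^sup>+t. w x * indicator {0<..<h x} t \<partial>lborel) \<partial>M)"
    by (intro nn_integral_cong) (auto simp: indicator_def)
  also have "\<dots> = (\<integral>\<^sup>+x. ennreal (h x) * w x \<partial>M)"
  proof (intro nn_integral_cong)
    fix x
    have "emeasure lborel {0<..<h x} = ennreal (h x)" by (cases "0 \<le> h x") (auto simp: ennreal_neg)
    then show "(\<integral>\<^sup>+t. w x * indicator {0<..<h x} t \<partial>lborel) = ennreal (h x) * w x"
      by (simp add: nn_integral_cmult_indicator mult.commute)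
  qed
  finally show "(\<integral>\<^sup>+x. ennreal (h x) * w x \<partial>M)
       = (\<integral>\<^sup>+t. indicator {0<..} t * (\<integral>\<^sup>+x. indicator {t<..} (h x) * w x \<partial>M) \<partial>lborel)" ..
  have "(\<integral>\<^sup>+t. indicator {0<..} t * (\<integral>\<^sup>+x. indicator {t..} (h x) * w x \<partial>M) \<partial>lborel)
      = (\<integral>\<^sup>+t. (\<integral>\<^sup>+x. indicator {0<..} t * (indicator {t..} (h x) * w x) \<partial>M) \<partial>lborel)"
    unfolding ind by (intro nn_integral_cong nn_integral_cmult[symmetric]) measurable
  also have "\<dots> = (\<integral>\<^sup>+x. (\<integral>\<^sup>+t. indicator {0<..} t * (indicator {t..} (h x) * w x) \<partial>lborel) \<partial>M)"
    unfolding ind by (rule P.Fubini') measurable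
  also have "\<dots> = (\<integral>\<^sup>+x. (\<integral>\<^sup>+t. w x * indicator {0<..h x} t \<partial>lborel) \<partial>M)"
    by (intro nn_integral_cong) (auto simp: indicator_def)
  also have "\<dots> = (\<integral>\<^sup>+x. ennreal (h x) * w x \<partial>M)"
  proof (intro nn_integral_cong)
    fix x
    have "emeasure lborel {0<..h x} = ennreal (h x)" by (cases "0 \<le> h x") (auto simp: ennreal_neg)
    then show "(\<integral>\<^sup>+t. w x * indicator {0<..h x} t \<partial>lborel) = ennreal (h x) * w x"
      by (simp add: nn_integral_cmult_indicator mult.commute)
  qed
  finally show "(\<integral>\<^sup>+x. ennreal (h x) * w x \<partial>M)
       = (\<integral>\<^sup>+t. indicator {0<..} t * (\<integral>\<^sup>+x. indicator {t..} (h x) * w x \<partial>M) \<partial>lborel)" ..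
qed

lemma ediff_mono:
  assumes "a \<le> a'" "b' \<le> b"
  shows "ediff a b \<le> ediff a' b'"
proof (cases "a = \<infinity> \<and> b = \<infinity>")
  case True
  then show ?thesis by (simp add: ediff_def)
next
  case False
  then show ?thesis using assms
    by (cases a; cases b; cases a'; cases b') (auto simp: ediff_def top_unique ennreal_le_iff)
qed

lemma densities_measurable: "Z \<in> densities M \<Longrightarrow> Z \<in> borel_measurable M"
  by (simp add: densities_def)

lemma densities_distr_cong:
  assumes Z: "Z \<in> densities M" and Z'[measurable]: "Z' \<in> borel_measurable M"
    and eq: "distr M borel Z' = distr M borel Z"
  shows "Z' \<in> densities M"
proof -
  note [measurable] = densities_measurable[OF Z]
  have "(AE x in M. 0 \<le> Z' x) \<longleftrightarrow> (AE y in distr M borel Z'. 0 \<le> y)"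
    by (subst AE_distr_iff) auto
  also have "\<dots> \<longleftrightarrow> (AE x in M. 0 \<le> Z x)"
    unfolding eq by (subst AE_distr_iff) auto
  finally have "AE x in M. 0 \<le> Z' x" using Z by (simp add: densities_def)
  moreover have "(\<integral>\<^sup>+x. ennreal (Z' x) \<partial>M) = (\<integral>\<^sup>+y. ennreal y \<partial>distr M borel Z')"
    by (subst nn_integral_distr) auto
  then have "(\<integral>\<^sup>+x. ennreal (Z' x) \<partial>M) = 1"
    unfolding eq using Z by (subst (asm) nn_integral_distr) (auto simp: densities_def)
  ultimately show ?thesis using Z' by (simp add: densities_def)
qed

text \<open>First-order stochastic dominance: the hypothesis compares the distribution functions of
  \<open>X'\<close> under \<open>Z'\<close> and of \<open>X\<close> under \<open>Z\<close>. The
  layer-cake formula makes the positive part antitone and the negative part monotone in the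
  distribution function, and \<open>ediff_mono\<close> also covers infinite parts.\<close>

lemma (in prob_space) EQ_mono_dominance:
  assumes Z: "Z \<in> densities M" "Z' \<in> densities M"
    and [measurable]: "X \<in> borel_measurable M" "X' \<in> borel_measurable M"
    and le: "\<And>t. (\<integral>\<^sup>+x. indicator {..t} (X' x) * ennreal (Z' x) \<partial>M)
                 \<le> (\<integral>\<^sup>+x. indicator {..t} (X x) * ennreal (Z x) \<partial>M)"
  shows "EQ M Z X \<le> EQ M Z' X'"
proof -
  note [measurable] = densities_measurable[OF Z(1)] densities_measurable[OF Z(2)]
  have compl: "(\<integral>\<^sup>+x. indicator {t<..} (Y x) * ennreal (R x) \<partial>M)
      = 1 - (\<integral>\<^sup>+x. indicator {..t} (Y x) * ennreal (R x) \<partial>M)"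
    if R: "R \<in> densities M" and [measurable]: "Y \<in> borel_measurable M" for R Y and t :: real
  proof -
    note [measurable] = densities_measurable[OF R]
    have "(\<integral>\<^sup>+x. indicator {..t} (Y x) * ennreal (R x) \<partial>M) + (\<integral>\<^sup>+x. indicator {t<..} (Y x) * ennreal (R x) \<partial>M)
        = (\<integral>\<^sup>+x. indicator {..t} (Y x) * ennreal (R x) + indicator {t<..} (Y x) * ennreal (R x) \<partial>M)"
      by (rule nn_integral_add[symmetric]) measurable
    also have "\<dots> = (\<integral>\<^sup>+x. ennreal (R x) \<partial>M)"
      by (intro nn_integral_cong) (auto simp: indicator_def)
    also have "\<dots> = 1" using R by (simp add: densities_def)
    finally have sum: "(\<integral>\<^sup>+x. indicator {..t} (Y x) * ennreal (R x) \<partial>M) + (\<integral>\<^sup>+x. indicator {t<..} (Y x) * ennreal (R x) \<partial>M) = 1" .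
    moreover from sum have "(\<integral>\<^sup>+x. indicator {..t} (Y x) * ennreal (R x) \<partial>M) \<noteq> \<top>" by (auto simp: ennreal_add_eq_top)
    ultimately show ?thesis by (metis ennreal_add_diff_cancel_left)
  qed
  have pos: "(\<integral>\<^sup>+x. ennreal (R x) * ennreal (max (Y x) 0) \<partial>M)
      = (\<integral>\<^sup>+t. indicator {0<..} t * (1 - (\<integral>\<^sup>+x. indicator {..t} (Y x) * ennreal (R x) \<partial>M)) \<partial>lborel)"
    if R: "R \<in> densities M" and [measurable]: "Y \<in> borel_measurable M" for R Y
  proof -
    note [measurable] = densities_measurable[OF R]
    have "(\<integral>\<^sup>+x. ennreal (R x) * ennreal (max (Y x) 0) \<partial>M) = (\<integral>\<^sup>+x. ennreal (max (Y x) 0) * ennreal (R x) \<partial>M)"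
      by (simp add: mult.commute)
    also have "\<dots> = (\<integral>\<^sup>+t. indicator {0<..} t * (\<integral>\<^sup>+x. indicator {t<..} (max (Y x) 0) * ennreal (R x) \<partial>M) \<partial>lborel)"
      by (rule nn_integral_layer_cake) measurable
    also have "\<dots> = (\<integral>\<^sup>+t. indicator {0<..} t * (\<integral>\<^sup>+x. indicator {t<..} (Y x) * ennreal (R x) \<partial>M) \<partial>lborel)"
      by (intro nn_integral_cong) (auto simp: indicator_def intro!: nn_integral_cong)
    also have "\<dots> = (\<integral>\<^sup>+t. indicator {0<..} t * (1 - (\<integral>\<^sup>+x. indicator {..t} (Y x) * ennreal (R x) \<partial>M)) \<partial>lborel)"
      using compl[OF that] by simp
    finally show ?thesis .
  qed
  have neg: "(\<integral>\<^sup>+x. ennreal (R x) * ennreal (max (- Y x) 0) \<partial>M)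
      = (\<integral>\<^sup>+t. indicator {0<..} t * (\<integral>\<^sup>+x. indicator {..-t} (Y x) * ennreal (R x) \<partial>M) \<partial>lborel)"
    if R: "R \<in> densities M" and [measurable]: "Y \<in> borel_measurable M" for R Y
  proof -
    note [measurable] = densities_measurable[OF R]
    have "(\<integral>\<^sup>+x. ennreal (R x) * ennreal (max (- Y x) 0) \<partial>M) = (\<integral>\<^sup>+x. ennreal (max (- Y x) 0) * ennreal (R x) \<partial>M)"
      by (simp add: mult.commute)
    also have "\<dots> = (\<integral>\<^sup>+t. indicator {0<..} t * (\<integral>\<^sup>+x. indicator {t..} (max (- Y x) 0) * ennreal (R x) \<partial>M) \<partial>lborel)"
      by (rule nn_integral_layer_cake_weak) measurable
    also have "\<dots> = (\<integral>\<^sup>+t. indicator {0<..} t * (\<integral>\<^sup>+x. indicator {..-t} (Y x) * ennreal (R x) \<partial>M) \<partial>lborel)"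
      by (intro nn_integral_cong) (auto simp: indicator_def intro!: nn_integral_cong)
    finally show ?thesis .
  qed
  show ?thesis
    unfolding EQ_def pos[OF Z(1) assms(3)] pos[OF Z(2) assms(4)] neg[OF Z(1) assms(3)] neg[OF Z(2) assms(4)]
    by (intro ediff_mono nn_integral_mono mult_left_mono le ennreal_minus_mono) auto
qed

text \<open>Hardy--Littlewood: among all couplings of given marginals, the antimonotone one minimises the
  expectation of the product, because it attains the Frechet upper bound for
  \<open>P(Z > y, X \<le> t)\<close> simultaneously for all \<open>y\<close> and \<open>t\<close>.\<close>

lemma (in prob_space) EQ_antimonotone_le:
  assumes U: "uniform_var M U"
    and Z: "Z \<in> densities M" and X[measurable]: "X \<in> borel_measurable M"
    and ZU: "\<And>y. AE x in M. U x < 1 - cdf (distr M borel Z) y \<longrightarrow> y < Z x"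
    and XU: "\<And>t. AE x in M. U x \<le> cdf (distr M borel X) t \<longrightarrow> X x \<le> t"
    and Z'[measurable]: "Z' \<in> borel_measurable M" and Z'eq: "distr M borel Z' = distr M borel Z"
    and X'[measurable]: "X' \<in> borel_measurable M" and X'eq: "distr M borel X' = distr M borel X"
  shows "EQ M Z X \<le> EQ M Z' X'"
proof (rule EQ_mono_dominance[OF Z _ X X'])
  note [measurable] = densities_measurable[OF Z] uniform_var_measurable[OF U]
  show "Z' \<in> densities M" by (rule densities_distr_cong[OF Z Z' Z'eq])
  fix t :: real
  \<comment> \<open>A layer-cake expansion in the density reduces the claim to joint probabilities
    of \<open>y < R x\<close> and \<open>Y x \<le> t\<close>, one for each level
    \<open>y\<close>.\<close>
  have joint: "(\<integral>\<^sup>+x. indicator {..t} (Y x) * ennreal (R x) \<partial>M)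
      = (\<integral>\<^sup>+y. indicator {0<..} y * ennreal (prob {x \<in> space M. y < R x \<and> Y x \<le> t}) \<partial>lborel)"
    if [measurable]: "R \<in> borel_measurable M" "Y \<in> borel_measurable M" for R Y
  proof -
    have "(\<integral>\<^sup>+x. indicator {..t} (Y x) * ennreal (R x) \<partial>M) = (\<integral>\<^sup>+x. ennreal (R x) * indicator {..t} (Y x) \<partial>M)"
      by (simp add: mult.commute)
    also have "\<dots> = (\<integral>\<^sup>+y. indicator {0<..} y * (\<integral>\<^sup>+x. indicator {y<..} (R x) * indicator {..t} (Y x) \<partial>M) \<partial>lborel)"
      by (rule nn_integral_layer_cake) measurable
    also have "(\<lambda>y. \<integral>\<^sup>+x. indicator {y<..} (R x) * indicator {..t} (Y x) \<partial>M)
        = (\<lambda>y. ennreal (prob {x \<in> space M. y < R x \<and> Y x \<le> t}))"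
    proof
      fix y
      have "(\<integral>\<^sup>+x. indicator {y<..} (R x) * indicator {..t} (Y x) \<partial>M)
          = (\<integral>\<^sup>+x. indicator {x \<in> space M. y < R x \<and> Y x \<le> t} x \<partial>M)"
        by (intro nn_integral_cong) (auto simp: indicator_def)
      then show "(\<integral>\<^sup>+x. indicator {y<..} (R x) * indicator {..t} (Y x) \<partial>M)
          = ennreal (prob {x \<in> space M. y < R x \<and> Y x \<le> t})"
        by (simp add: emeasure_eq_measure)
    qed
    finally show ?thesis .
  qed
  have "prob {x \<in> space M. y < Z' x \<and> X' x \<le> t} \<le> prob {x \<in> space M. y < Z x \<and> X x \<le> t}" for y
  proof -
    define p q where "p = 1 - cdf (distr M borel Z) y" and "q = cdf (distr M borel X) t"
    have "p = prob (space M - {x \<in> space M. Z' x \<le> y})"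
      unfolding p_def Z'eq[symmetric] cdf_distr_eq[OF Z'] by (subst prob_compl) auto
    then have p: "p = prob {x \<in> space M. y < Z' x}"
      by (simp add: not_le set_diff_eq conj_commute cong: conj_cong)
    have q: "q = prob {x \<in> space M. X' x \<le> t}"
      unfolding q_def X'eq[symmetric] by (rule cdf_distr_eq) simp
    have "prob {x \<in> space M. y < Z' x \<and> X' x \<le> t} \<le> min p q"
      unfolding p q by (auto intro!: finite_measure_mono)
    \<comment> \<open>By \<open>ZU\<close> and \<open>XU\<close> the event
      \<open>U x \<le> min p q\<close> implies both \<open>y < Z x\<close> and
      \<open>X x \<le> t\<close>, up to null sets. The strict inequality in \<open>ZU\<close> costs
      only the null event \<open>U x = p\<close>.\<close>
    also have "min p q = prob {x \<in> space M. U x \<le> min p q}"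
      using p q by (intro uniform_varD[OF U, symmetric]) (auto simp: min_def)
    also have "\<dots> \<le> prob {x \<in> space M. y < Z x \<and> X x \<le> t}"
      using ZU[of y] XU[of t] uniform_var_AE_neq[OF U, of p]
      by (intro finite_measure_mono_AE) (auto simp: p_def q_def)
    finally show ?thesis .
  qed
  then show "(\<integral>\<^sup>+x. indicator {..t} (X' x) * ennreal (Z' x) \<partial>M) \<le> (\<integral>\<^sup>+x. indicator {..t} (X x) * ennreal (Z x) \<partial>M)"
    by (subst (1 2) joint) (auto intro!: nn_integral_mono mult_left_mono ennreal_leI)
qed

text \<open>Since \<open>U\<close> increases with \<open>X\<close>, evaluating the quantile at
  \<open>1 - U\<close> makes \<open>R\<close> decrease as \<open>X\<close> increases. This
  \<open>R\<close> is the minimiser used whenever \<open>X\<close> is kept and the density is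
  rearranged.\<close>

lemma (in prob_space) rearranged_density:
  assumes U: "uniform_var M U" and Z: "Z \<in> densities M" and X: "X \<in> borel_measurable M"
    and XU: "\<And>t. AE x in M. X x \<le> t \<longleftrightarrow> U x \<le> cdf (distr M borel X) t"
    and R_def: "R = (\<lambda>x. quantile (distr M borel Z) (1 - U x))"
  shows "R \<in> borel_measurable M" "distr M borel R = distr M borel Z" "R \<in> densities M"
    "AE x in M. \<forall>y. y < R x \<longleftrightarrow> U x < 1 - cdf (distr M borel Z) y"
    "\<And>Z' X'. Z' \<in> borel_measurable M \<Longrightarrow> distr M borel Z' = distr M borel Z \<Longrightarrow>
       X' \<in> borel_measurable M \<Longrightarrow> distr M borel X' = distr M borel X \<Longrightarrow> EQ M R X \<le> EQ M Z' X'"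
proof -
  note [measurable] = densities_measurable[OF Z] uniform_var_measurable[OF U]
  have N: "real_distribution (distr M borel Z)" by simp
  note [measurable] = measurable_quantile[OF N]
  show R[measurable]: "R \<in> borel_measurable M" unfolding R_def by measurable
  show eq: "distr M borel R = distr M borel Z"
    unfolding R_def by (rule distr_quantile[OF N uniform_var_flip[OF U]])
  show R': "R \<in> densities M" by (rule densities_distr_cong[OF Z R eq])
  show RU: "AE x in M. \<forall>y. y < R x \<longleftrightarrow> U x < 1 - cdf (distr M borel Z) y"
    using uniform_var_AE_Ioo[OF U]
  proof eventually_elim
    case (elim x)
    have "y < R x \<longleftrightarrow> \<not> 1 - U x \<le> cdf (distr M borel Z) y" for y
      using elim quantile_le_iff[OF N, of "1 - U x" y] by (simp add: R_def not_le flip: not_less)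
    then show ?case by (simp add: not_le less_diff_eq diff_less_eq add.commute)
  qed
  fix Z' X' assume "Z' \<in> borel_measurable M" "distr M borel Z' = distr M borel Z"
    "X' \<in> borel_measurable M" "distr M borel X' = distr M borel X"
  moreover have "AE x in M. U x < 1 - cdf (distr M borel R) y \<longrightarrow> y < R x" for y
    using RU unfolding eq by eventually_elim auto
  moreover have "AE x in M. U x \<le> cdf (distr M borel X) t \<longrightarrow> X x \<le> t" for t
    using XU[of t] by eventually_elim auto
  ultimately show "EQ M R X \<le> EQ M Z' X'"
    using eq by (intro EQ_antimonotone_le[OF U R' X]) auto
qed

text \<open>The mirror image of the preceding construction: the density is kept, \<open>U\<close>
  orders \<open>Z\<close>, and \<open>X\<close> is rearranged along the reversed variable
  \<open>V\<close>.\<close>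

lemma (in prob_space) ex_rearranged_variable:
  assumes atomless: "atomless M" and Z: "Z \<in> densities M" and X: "X \<in> borel_measurable M"
  shows "\<exists>R\<in>borel_measurable M. distr M borel R = distr M borel X \<and>
    (\<forall>Z'\<in>borel_measurable M. distr M borel Z' = distr M borel Z \<longrightarrow> EQ M Z R \<le> EQ M Z' X)"
proof -
  obtain U where U: "uniform_var M U" and ZU: "\<And>y. AE x in M. Z x \<le> y \<longleftrightarrow> U x \<le> cdf (distr M borel Z) y"
    using atomless_uniform_order[OF atomless densities_measurable[OF Z]] by blast
  define V where "V x = 1 - U x" for x
  have V: "uniform_var M V" unfolding V_def by (rule uniform_var_flip[OF U])
  have N: "real_distribution (distr M borel X)" using X by simp
  note [measurable] = densities_measurable[OF Z] uniform_var_measurable[OF V] X measurable_quantile[OF N]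
  define R where "R x = quantile (distr M borel X) (V x)" for x
  have R[measurable]: "R \<in> borel_measurable M" unfolding R_def by measurable
  have eq: "distr M borel R = distr M borel X" unfolding R_def by (rule distr_quantile[OF N V])
  have 1: "AE x in M. V x < 1 - cdf (distr M borel Z) y \<longrightarrow> y < Z x" for y
    using ZU[of y] by eventually_elim (auto simp: V_def)
  have 2: "AE x in M. V x \<le> cdf (distr M borel R) t \<longrightarrow> R x \<le> t" for t
    unfolding eq using uniform_var_AE_Ioo[OF V]
    by eventually_elim (auto simp: R_def quantile_le_iff[OF N])
  have "EQ M Z R \<le> EQ M Z' X" if "Z' \<in> borel_measurable M" "distr M borel Z' = distr M borel Z" for Z'
    by (rule EQ_antimonotone_le[OF V Z R 1 2 that X eq[symmetric]])
  with R eq show ?thesis by blast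
qed

section \<open>Law invariance of a utility and of its determining set\<close>

text \<open>With \<open>R\<close> the rearrangement of \<open>X\<close> antimonotone to
  \<open>Z\<close>, law invariance gives the chain from \<open>u X = u R\<close> through
  \<open>EQ M Z R\<close> to \<open>EQ M Z' X\<close>.\<close>

lemma (in prob_space) law_invariant_determining_set:
  assumes atomless: "atomless M" and u: "law_invariant_utility M u"
  shows "law_invariant_set M (determining_set M u)"
  unfolding law_invariant_set_def
proof (intro ballI impI)
  fix Z Z' assume Z: "Z \<in> determining_set M u" and Z': "Z' \<in> borel_measurable M"
    and eq: "distr M borel Z' = distr M borel Z"
  have Zd: "Z \<in> densities M" using Z by (simp add: determining_set_def)
  have "u X \<le> EQ M Z' X" if X: "X \<in> borel_measurable M" for X
  proof -
    obtain R where R: "R \<in> borel_measurable M" "distr M borel R = distr M borel X" "EQ M Z R \<le> EQ M Z' X"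
      using ex_rearranged_variable[OF atomless Zd X] Z' eq by blast
    have "u X = u R" using u X R unfolding law_invariant_utility_def by metis
    also have "\<dots> \<le> EQ M Z R" using Z R by (simp add: determining_set_def)
    finally show ?thesis using R(3) by simp
  qed
  with densities_distr_cong[OF Zd Z' eq] show "Z' \<in> determining_set M u"
    by (simp add: determining_set_def)
qed

text \<open>Each \<open>Z\<close> in \<open>D\<close> can be traded for a rearrangement in
  \<open>D\<close> that does at least as well against \<open>X'\<close>. Any representing set
  \<open>D\<close> is allowed, so the result applies to \<open>u_lambda\<close> through its defining
  set as well as to determining sets.\<close>

lemma (in prob_space) law_invariant_INF:
  assumes atomless: "atomless M" and D: "law_invariant_set M D" "D \<subseteq> densities M"
    and u: "\<And>X. X \<in> borel_measurable M \<Longrightarrow> u X = (INF Z\<in>D. EQ M Z X)"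
  shows "law_invariant_utility M u"
proof -
  have le: "u X' \<le> u X" if X: "X \<in> borel_measurable M" "X' \<in> borel_measurable M"
    "distr M borel X = distr M borel X'" for X X'
    unfolding u[OF X(1)] u[OF X(2)]
  proof (rule INF_mono)
    fix Z assume Z: "Z \<in> D"
    obtain U where U: "uniform_var M U" "\<And>t. AE x in M. X' x \<le> t \<longleftrightarrow> U x \<le> cdf (distr M borel X') t"
      using atomless_uniform_order[OF atomless X(2)] by blast
    have Zd: "Z \<in> densities M" using Z D by auto
    note R = rearranged_density[OF U(1) Zd X(2) U(2) refl]
    have "quantile (distr M borel Z) \<circ> (\<lambda>x. 1 - U x) \<in> D"
      using D(1) Z R(1,2) unfolding law_invariant_set_def comp_def by simp
    then show "\<exists>R\<in>D. EQ M R X' \<le> EQ M Z X"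
      using R(5)[OF densities_measurable[OF Zd] refl X(1,3)] unfolding comp_def by (intro bexI) auto
  qed
  show ?thesis unfolding law_invariant_utility_def
  proof (intro ballI impI order_antisym)
    fix X X' :: "'a \<Rightarrow> real" assume *: "X \<in> borel_measurable M" "X' \<in> borel_measurable M" "distr M borel X = distr M borel X'"
    show "u X \<le> u X'" by (rule le[OF *(2,1) *(3)[symmetric]])
    show "u X' \<le> u X" by (rule le[OF *])
  qed
qed

section \<open>Weighted V@R\<close>

lemma ediff_infinity_right: "ediff a \<infinity> = - \<infinity>"
  by (cases a) (auto simp: ediff_def)

text \<open>Positive and negative part of an \<open>ediff\<close>. An infinite \<open>b\<close>
  forces the value minus infinity whatever \<open>a\<close> is, hence the separate case; otherwise
  truncated subtraction gives the parts.\<close>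

lemma e2ennreal_ediff:
  "e2ennreal (ediff a b) = (if b = \<infinity> then 0 else a - b)"
  "e2ennreal (- ediff a b) = (if b = \<infinity> then \<infinity> else b - a)"
proof -
  have "e2ennreal (ediff a b) = (if b = \<infinity> then 0 else a - b) \<and> e2ennreal (- ediff a b) = (if b = \<infinity> then \<infinity> else b - a)"
    by (cases a; cases b)
      (auto simp: ediff_def ennreal_minus e2ennreal_neg zero_ereal_def top_ereal_def)
  then show "e2ennreal (ediff a b) = (if b = \<infinity> then 0 else a - b)"
    "e2ennreal (- ediff a b) = (if b = \<infinity> then \<infinity> else b - a)" by auto
qed

lemma ediff_eqI:
  assumes "a + n = b + p" "n \<le> b" "b \<noteq> \<infinity>"
  shows "ediff a b = ediff p n"
  using assms
  by (cases a; cases b; cases p; cases n)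
    (auto simp: ediff_def top_unique ennreal_le_iff simp flip: ennreal_plus)

text \<open>Splitting the difference \<open>f - g\<close> into its positive and negative part before or after the
  integration gives the same result, unless the cancellation makes an infinite integral of \<open>g\<close> finite.\<close>

lemma ediff_nn_integral:
  assumes [measurable]: "f \<in> borel_measurable \<mu>" "g \<in> borel_measurable \<mu>"
    and inf: "(\<integral>\<^sup>+l. g l \<partial>\<mu>) = \<infinity> \<Longrightarrow> (\<integral>\<^sup>+l. e2ennreal (- ediff (f l) (g l)) \<partial>\<mu>) = \<infinity>"
  shows "ediff (\<integral>\<^sup>+l. f l \<partial>\<mu>) (\<integral>\<^sup>+l. g l \<partial>\<mu>)
    = ediff (\<integral>\<^sup>+l. e2ennreal (ediff (f l) (g l)) \<partial>\<mu>) (\<integral>\<^sup>+l. e2ennreal (- ediff (f l) (g l)) \<partial>\<mu>)"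
proof (cases "(\<integral>\<^sup>+l. g l \<partial>\<mu>) = \<infinity>")
  case True
  show ?thesis by (simp only: True inf[OF True] ediff_infinity_right)
next
  case False
  then have fin: "AE l in \<mu>. g l \<noteq> \<infinity>" by (intro nn_integral_PInf_AE) auto
  show ?thesis
  proof (rule ediff_eqI)
    show "(\<integral>\<^sup>+l. f l \<partial>\<mu>) + (\<integral>\<^sup>+l. e2ennreal (- ediff (f l) (g l)) \<partial>\<mu>)
        = (\<integral>\<^sup>+l. g l \<partial>\<mu>) + (\<integral>\<^sup>+l. e2ennreal (ediff (f l) (g l)) \<partial>\<mu>)"
      unfolding e2ennreal_ediff
    proof (subst (1 2) nn_integral_add[symmetric])
      show "(\<integral>\<^sup>+l. f l + (if g l = \<infinity> then \<infinity> else g l - f l) \<partial>\<mu>) = (\<integral>\<^sup>+l. g l + (if g l = \<infinity> then 0 else f l - g l) \<partial>\<mu>)"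
      proof (rule nn_integral_cong_AE, use fin in eventually_elim)
        case (elim l)
        \<comment> \<open>With truncated subtraction both sides equal the maximum of
          \<open>f l\<close> and \<open>g l\<close>.\<close>
        have "f l + (g l - f l) = g l + (f l - g l)"
          using elim by (cases "f l"; cases "g l"; cases "f l \<le> g l")
            (auto simp: ennreal_minus ennreal_neg ennreal_le_iff not_le simp flip: ennreal_plus)
        with elim show ?case by simp
      qed
    qed measurable
    show "(\<integral>\<^sup>+l. e2ennreal (- ediff (f l) (g l)) \<partial>\<mu>) \<le> (\<integral>\<^sup>+l. g l \<partial>\<mu>)"
      unfolding e2ennreal_ediff
      using fin by (intro nn_integral_mono_AE) (auto simp: diff_le_self_ennreal)
  qed fact
qed

section \<open>Tail expectations along a uniform ordering of \<open>X\<close>\<close>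

locale uniform_order = prob_space M for M :: "'a measure" +
  fixes U X :: "'a \<Rightarrow> real"
  assumes U: "uniform_var M U" and X[measurable]: "X \<in> borel_measurable M"
    and XU: "\<And>t. AE x in M. X x \<le> t \<longleftrightarrow> U x \<le> cdf (distr M borel X) t"
begin

lemma U_measurable[measurable]: "U \<in> borel_measurable M"
  by (rule uniform_var_measurable[OF U])

text \<open>As \<open>U\<close> orders \<open>X\<close>, the event \<open>U x \<le> l\<close>
  collects the lowest outcomes of \<open>X\<close> with total probability \<open>l\<close>, for
  \<open>l\<close> in the unit interval. Dividing by such a positive \<open>l\<close> gives the
  average of \<open>w\<close> over them.\<close>

definition head :: "('a \<Rightarrow> ennreal) \<Rightarrow> real \<Rightarrow> ennreal" where
  "head w l = (\<integral>\<^sup>+x. indicator {..l} (U x) * w x \<partial>M)"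

lemma head_measurable[measurable]:
  assumes [measurable]: "w \<in> borel_measurable M"
  shows "head w \<in> borel_measurable borel"
proof -
  have "head w = (\<lambda>l. \<integral>\<^sup>+x. (if U x \<le> l then 1 else 0) * w x \<partial>M)"
    unfolding head_def by (intro ext nn_integral_cong) (auto simp: indicator_def)
  also have "\<dots> \<in> borel_measurable borel" by measurable
  finally show ?thesis .
qed

lemma head_le: "head w l \<le> (\<integral>\<^sup>+x. w x \<partial>M)"
  unfolding head_def by (intro nn_integral_mono) (auto simp: indicator_def)

text \<open>The infimum is attained at the density \<open>R\<close> that spreads mass uniformly over
  the event \<open>U x \<le> l\<close>: under the bound \<open>1 / l\<close> no density puts more
  mass on a lower tail of \<open>X\<close>.\<close>

lemma u_lambda_eq:
  assumes l: "0 < l" "l \<le> 1"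
  shows "u_lambda M l X = ediff (ennreal (1 / l) * head (\<lambda>x. ennreal (max (X x) 0)) l)
                                (ennreal (1 / l) * head (\<lambda>x. ennreal (max (- X x) 0)) l)"
proof -
  define R where "R x = (1 / l) * indicator {..l} (U x)" for x
  have [measurable]: "R \<in> borel_measurable M" unfolding R_def by measurable
  have ennR: "ennreal (R x) = ennreal (1 / l) * indicator {..l} (U x)" for x
    by (auto simp: R_def indicator_def)
  have prob_U: "(\<integral>\<^sup>+x. indicator {..r} (U x) \<partial>M) = ennreal r" if "0 \<le> r" "r \<le> 1" for r
  proof -
    have "(\<integral>\<^sup>+x. indicator {..r} (U x) \<partial>M) = (\<integral>\<^sup>+x. indicator {x \<in> space M. U x \<le> r} x \<partial>M)"
      by (intro nn_integral_cong) (auto simp: indicator_def)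
    also have "\<dots> = ennreal r" using uniform_varD[OF U that] by (simp add: emeasure_eq_measure)
    finally show ?thesis .
  qed
  have inv: "ennreal (1 / l) * ennreal l = 1" using l by (simp flip: ennreal_mult')
  have R: "R \<in> densities M"
    unfolding densities_def using l prob_U[of l]
    by (auto simp: ennR nn_integral_cmult inv) (auto simp: R_def)
  have EQ_R: "EQ M R X = ediff (ennreal (1 / l) * head (\<lambda>x. ennreal (max (X x) 0)) l)
                                (ennreal (1 / l) * head (\<lambda>x. ennreal (max (- X x) 0)) l)"
    unfolding EQ_def head_def ennR by (simp add: nn_integral_cmult mult.assoc)
  have min: "EQ M R X \<le> EQ M Z X" if Z: "Z \<in> densities M" "AE x in M. Z x \<le> 1 / l" for Z
  proof (rule EQ_mono_dominance[OF R Z(1) X X])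
    fix t
    note [measurable] = densities_measurable[OF Z(1)]
    define c where "c = cdf (distr M borel X) t"
    have c: "0 \<le> c" "c \<le> 1" unfolding c_def cdf_distr_eq[OF X] by auto
    \<comment> \<open>The mass of the lower tail is at most \<open>1\<close> and at most
      \<open>c / l\<close>; the density \<open>R\<close> attains the smaller of the two.\<close>
    have 1: "(\<integral>\<^sup>+x. indicator {..t} (X x) * ennreal (Z x) \<partial>M) \<le> 1"
    proof -
      have "(\<integral>\<^sup>+x. indicator {..t} (X x) * ennreal (Z x) \<partial>M) \<le> (\<integral>\<^sup>+x. ennreal (Z x) \<partial>M)"
        by (intro nn_integral_mono) (auto simp: indicator_def)
      then show ?thesis using Z(1) by (simp add: densities_def)
    qed
    have 2: "(\<integral>\<^sup>+x. indicator {..t} (X x) * ennreal (Z x) \<partial>M) \<le> ennreal (1 / l) * ennreal c"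
    proof -
      have "(\<integral>\<^sup>+x. indicator {..t} (X x) * ennreal (Z x) \<partial>M) \<le> (\<integral>\<^sup>+x. ennreal (1 / l) * indicator {..c} (U x) \<partial>M)"
      proof (rule nn_integral_mono_AE, use Z(2) XU[of t] in eventually_elim)
        case (elim x)
        then show ?case by (auto simp: indicator_def c_def intro: ennreal_leI)
      qed
      also have "\<dots> = ennreal (1 / l) * ennreal c" using prob_U[OF c] by (simp add: nn_integral_cmult)
      finally show ?thesis .
    qed
    have "(\<integral>\<^sup>+x. indicator {..t} (X x) * ennreal (R x) \<partial>M) = (\<integral>\<^sup>+x. ennreal (1 / l) * indicator {..min l c} (U x) \<partial>M)"
    proof (rule nn_integral_cong_AE, use XU[of t] in eventually_elim)
      case (elim x)
      then show ?case by (auto simp: ennR indicator_def c_def)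
    qed
    also have "\<dots> = ennreal (1 / l) * ennreal (min l c)"
      using prob_U[of "min l c"] c l by (simp add: nn_integral_cmult)
    finally show "(\<integral>\<^sup>+x. indicator {..t} (X x) * ennreal (Z x) \<partial>M) \<le> (\<integral>\<^sup>+x. indicator {..t} (X x) * ennreal (R x) \<partial>M)"
      using 1 2 inv by (simp add: min_def)
  qed
  have "u_lambda M l X = EQ M R X"
    unfolding u_lambda_def
  proof (rule antisym)
    show "(INF Z\<in>{Z \<in> densities M. AE x in M. Z x \<le> 1 / l}. EQ M Z X) \<le> EQ M R X"
      using R l by (intro INF_lower) (auto simp: R_def indicator_def)
    show "EQ M R X \<le> (INF Z\<in>{Z \<in> densities M. AE x in M. Z x \<le> 1 / l}. EQ M Z X)"
      using min by (intro INF_greatest) auto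
  qed
  with EQ_R show ?thesis by simp
qed

text \<open>Near \<open>0\<close> only the negative part of \<open>X\<close> contributes to \<open>u_lambda M l X\<close>.\<close>

lemma u_lambda_negative_part_infinite:
  assumes \<mu>: "prob_on_unit \<mu>"
    and f_def: "f = (\<lambda>l. ennreal (1 / l) * head (\<lambda>x. ennreal (max (X x) 0)) l)"
    and g_def: "g = (\<lambda>l. ennreal (1 / l) * head (\<lambda>x. ennreal (max (- X x) 0)) l)"
    and inf: "(\<integral>\<^sup>+l. g l \<partial>\<mu>) = \<infinity>"
  shows "(\<integral>\<^sup>+l. e2ennreal (- ediff (f l) (g l)) \<partial>\<mu>) = \<infinity>"
proof -
  interpret \<mu>: prob_space \<mu> using \<mu> by (simp add: prob_on_unit_def)
  have sets: "sets \<mu> = sets (restrict_space borel {0<..1})" using \<mu> by (simp add: prob_on_unit_def)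
  have space: "space \<mu> = {0<..1}" using sets_eq_imp_space_eq[OF sets] by (simp add: space_restrict_space)
  have borel: "h \<in> borel_measurable borel \<Longrightarrow> h \<in> borel_measurable \<mu>" for h :: "real \<Rightarrow> ennreal"
    using measurable_restrict_space1[of h borel borel "{0<..1}"] measurable_cong_sets[OF sets refl] by blast
  define w where "w x = ennreal (max (- X x) 0)" for x
  have [measurable]: "w \<in> borel_measurable M" unfolding w_def by measurable
  interpret N: real_distribution "distr M borel X" by simp
  show ?thesis
  proof (cases "(\<integral>\<^sup>+x. w x \<partial>M) = \<infinity>")
    case True
    have "g l = \<infinity>" if l: "l \<in> {0<..1}" for l
    proof -
      \<comment> \<open>Choosing \<open>t\<close> with distribution function below \<open>l\<close>
        gives \<open>t < X x\<close> almost everywhere off the event \<open>U x \<le> l\<close>.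
        There \<open>w\<close> is bounded, so its infinite integral sits entirely in
        \<open>head w l\<close>.\<close>
      have "eventually (\<lambda>t. cdf (distr M borel X) t < l) at_bot"
        using l by (intro order_tendstoD(2)[OF N.cdf_lim_at_bot]) auto
      then obtain t where t: "cdf (distr M borel X) t < l"
        by (meson eventually_happens' trivial_limit_at_bot_linorder)
      have "(\<integral>\<^sup>+x. w x \<partial>M) \<le> (\<integral>\<^sup>+x. indicator {..l} (U x) * w x + ennreal (max (- t) 0) \<partial>M)"
      proof (rule nn_integral_mono_AE, use XU[of t] in eventually_elim)
        case (elim x)
        show ?case
        proof (cases "U x \<le> l")
          case False
          then have "t < X x" using elim t by auto
          then have "w x \<le> ennreal (max (- t) 0)" unfolding w_def by (intro ennreal_leI) auto
          with False show ?thesis by simp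
        qed auto
      qed
      also have "\<dots> = head w l + ennreal (max (- t) 0)"
        unfolding head_def by (subst nn_integral_add) (auto simp: emeasure_space_1)
      finally have "head w l = \<infinity>" using True by (auto simp: top_unique)
      then show ?thesis using l unfolding g_def w_def[abs_def, symmetric]
        by (simp add: ennreal_mult_top)
    qed
    then have "(\<integral>\<^sup>+l. e2ennreal (- ediff (f l) (g l)) \<partial>\<mu>) = (\<integral>\<^sup>+l. \<infinity> \<partial>\<mu>)"
      unfolding e2ennreal_ediff by (intro nn_integral_cong) (simp add: space)
    then show ?thesis by (simp add: \<mu>.emeasure_space_1)
  next
    case False
    \<comment> \<open>For \<open>l\<close> up to \<open>c\<close>, the probability of
      \<open>X x \<le> 0\<close>, the positive part has no head and nothing cancels. For larger
      \<open>l\<close> the factor \<open>1 / l\<close> is below \<open>1 / c\<close>, so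
      \<open>g l\<close> is at most the finite constant \<open>K\<close>.\<close>
    define c where "c = cdf (distr M borel X) 0"
    have "c \<noteq> 0"
    proof
      assume "c = 0"
      have "AE x in M. w x = 0"
        using XU[of 0] uniform_var_AE_Ioo[OF U]
      proof eventually_elim
        case (elim x)
        then show ?case using \<open>c = 0\<close> by (auto simp: c_def w_def ennreal_neg)
      qed
      then have "(\<integral>\<^sup>+x. w x \<partial>M) = 0" by (simp add: nn_integral_0_iff_AE)
      then have "head w l = 0" for l using head_le[of w l] by simp
      then have "(\<integral>\<^sup>+l. g l \<partial>\<mu>) = 0" unfolding g_def w_def[abs_def, symmetric] by simp
      with inf show False by simp
    qed
    then have c: "0 < c" using N.cdf_nonneg[of 0] by (simp add: c_def)
    define K where "K = ennreal (1 / c) * (\<integral>\<^sup>+x. w x \<partial>M)"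
    have K: "K \<noteq> \<infinity>" using False by (auto simp: K_def ennreal_mult_eq_top_iff)
    have "g l \<le> e2ennreal (- ediff (f l) (g l)) + K" if l: "l \<in> {0<..1}" for l
    proof (cases "l \<le> c")
      case True
      have "AE x in M. indicator {..l} (U x) * ennreal (max (X x) 0) = 0"
        using XU[of 0]
      proof eventually_elim
        case (elim x)
        then show ?case using True by (auto simp: c_def indicator_def ennreal_neg max_def)
      qed
      then have "f l = 0" unfolding f_def head_def by (simp add: nn_integral_0_iff_AE)
      then show ?thesis unfolding e2ennreal_ediff by simp
    next
      case False
      have "g l \<le> ennreal (1 / c) * (\<integral>\<^sup>+x. w x \<partial>M)"
        unfolding g_def w_def[abs_def, symmetric] using False c
        by (intro mult_mono head_le ennreal_leI) (auto simp: frac_le)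
      then show ?thesis by (simp add: K_def add_increasing)
    qed
    then have "(\<integral>\<^sup>+l. g l \<partial>\<mu>) \<le> (\<integral>\<^sup>+l. e2ennreal (- ediff (f l) (g l)) + K \<partial>\<mu>)"
      by (intro nn_integral_mono) (simp add: space)
    also have "\<dots> = (\<integral>\<^sup>+l. e2ennreal (- ediff (f l) (g l)) \<partial>\<mu>) + K"
      unfolding e2ennreal_ediff f_def g_def
      by (subst nn_integral_add) (auto simp: \<mu>.emeasure_space_1 intro!: borel)
    finally show ?thesis using K inf by (auto simp: top_unique)
  qed
qed

end

text \<open>With \<open>m(y) = P(Z > y)\<close>, the layer-cake formula writes the decreasing rearrangement of \<open>Z\<close> as the
  mixture of the functions \<open>1{s < m(y)} / m(y)\<close> with weights \<open>m(y) dy\<close>; the image of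
  \<open>m(y) dy\<close> under \<open>m\<close> is therefore the mixing measure of the corresponding Weighted V@R. Levels with
  \<open>m(y) = 0\<close> have weight zero and are sent to the irrelevant value \<open>1\<close>.\<close>

definition mixing_measure :: "real measure \<Rightarrow> real measure" where
  "mixing_measure N = distr (density lborel (\<lambda>y. indicator {0<..} y * ennreal (1 - cdf N y)))
     (restrict_space borel {0<..1}) (\<lambda>y. if cdf N y < 1 then 1 - cdf N y else 1)"

lemma nn_integral_mixing_measure:
  assumes N: "real_distribution N" and h: "h \<in> borel_measurable (restrict_space borel {0<..1})"
  shows "(\<integral>\<^sup>+l. h l \<partial>mixing_measure N)
    = (\<integral>\<^sup>+y. indicator {0<..} y * ennreal (1 - cdf N y) * h (if cdf N y < 1 then 1 - cdf N y else 1) \<partial>lborel)"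
proof -
  interpret cdf_distribution N using N by (simp add: cdf_distribution_def)
  let ?k = "\<lambda>y. if cdf N y < 1 then 1 - cdf N y else 1"
  have k: "?k \<in> measurable borel (restrict_space borel {0<..1})"
    by (rule measurable_restrict_space2) (auto simp: cdf_nonneg)
  have hk[measurable]: "(\<lambda>y. h (?k y)) \<in> borel_measurable borel"
    using measurable_compose[OF k h] .
  have "(\<integral>\<^sup>+l. h l \<partial>mixing_measure N)
    = (\<integral>\<^sup>+y. h (?k y) \<partial>density lborel (\<lambda>y. indicator {0<..} y * ennreal (1 - cdf N y)))"
    unfolding mixing_measure_def using k h by (intro nn_integral_distr) auto
  also have "\<dots> = (\<integral>\<^sup>+y. indicator {0<..} y * ennreal (1 - cdf N y) * h (?k y) \<partial>lborel)"
    by (rule nn_integral_density) auto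
  finally show ?thesis .
qed

lemma (in prob_space) nn_integral_tail:
  assumes [measurable]: "Z \<in> borel_measurable M"
  shows "(\<integral>\<^sup>+x. indicator {y<..} (Z x) \<partial>M) = ennreal (1 - cdf (distr M borel Z) y)"
proof -
  have "(\<integral>\<^sup>+x. indicator {y<..} (Z x) \<partial>M) = (\<integral>\<^sup>+x. indicator (space M - {x \<in> space M. Z x \<le> y}) x \<partial>M)"
    by (intro nn_integral_cong) (auto simp: indicator_def)
  also have "\<dots> = ennreal (prob (space M - {x \<in> space M. Z x \<le> y}))"
    by (simp add: emeasure_eq_measure)
  also have "prob (space M - {x \<in> space M. Z x \<le> y}) = 1 - cdf (distr M borel Z) y"
    by (subst prob_compl) (auto simp: cdf_distr_eq)
  finally show ?thesis .
qed

text \<open>The total mass is the integral of the tail probabilities of \<open>Z\<close> over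
  positive levels, which is the expectation of \<open>Z\<close>.\<close>

lemma (in prob_space) prob_on_unit_mixing_measure:
  assumes Z: "Z \<in> densities M"
  shows "prob_on_unit (mixing_measure (distr M borel Z))"
  unfolding prob_on_unit_def
proof (intro conjI prob_spaceI)
  note [measurable] = densities_measurable[OF Z]
  have N: "real_distribution (distr M borel Z)" by simp
  let ?\<mu> = "mixing_measure (distr M borel Z)"
  have "emeasure ?\<mu> (space ?\<mu>) = (\<integral>\<^sup>+l. 1 \<partial>?\<mu>)" by simp
  also have "\<dots> = (\<integral>\<^sup>+y. indicator {0<..} y * ennreal (1 - cdf (distr M borel Z) y) \<partial>lborel)"
    by (subst nn_integral_mixing_measure[OF N]) auto
  also have "\<dots> = (\<integral>\<^sup>+x. ennreal (Z x) * 1 \<partial>M)"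
    by (subst nn_integral_layer_cake) (auto simp: nn_integral_tail)
  also have "\<dots> = 1" using Z by (simp add: densities_def)
  finally show "emeasure ?\<mu> (space ?\<mu>) = 1" .
  show "sets ?\<mu> = sets (restrict_space borel {0<..1})" by (simp add: mixing_measure_def)
qed

text \<open>Substituting the tail probability of \<open>y\<close> for \<open>l\<close> cancels
  \<open>1 / l\<close> against the weight. Up to null sets the head at that level is the event
  \<open>y < R x\<close>, so the layer-cake formula reassembles the rearranged density.\<close>

lemma (in uniform_order) nn_integral_mixing_measure_head:
  assumes Z: "Z \<in> densities M" and w[measurable]: "w \<in> borel_measurable M"
  shows "(\<integral>\<^sup>+l. ennreal (1 / l) * head w l \<partial>mixing_measure (distr M borel Z))
    = (\<integral>\<^sup>+x. ennreal (quantile (distr M borel Z) (1 - U x)) * w x \<partial>M)"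
proof -
  note [measurable] = densities_measurable[OF Z]
  define R where "R = (\<lambda>x. quantile (distr M borel Z) (1 - U x))"
  note R = rearranged_density[OF U Z X XU R_def]
  note [measurable] = R(1)
  have N: "real_distribution (distr M borel Z)" by simp
  interpret N: real_distribution "distr M borel Z" by simp
  let ?m = "\<lambda>y. 1 - cdf (distr M borel Z) y"
  have "(\<integral>\<^sup>+l. ennreal (1 / l) * head w l \<partial>mixing_measure (distr M borel Z))
    = (\<integral>\<^sup>+y. indicator {0<..} y * (ennreal (?m y) * (ennreal (1 / (if 0 < ?m y then ?m y else 1)) * head w (if 0 < ?m y then ?m y else 1))) \<partial>lborel)"
    by (subst nn_integral_mixing_measure[OF N]) (auto simp: mult.assoc intro!: measurable_restrict_space1)
  also have "\<dots> = (\<integral>\<^sup>+y. indicator {0<..} y * (\<integral>\<^sup>+x. indicator {y<..} (R x) * w x \<partial>M) \<partial>lborel)"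
  proof (intro nn_integral_cong arg_cong2[where f = "(*)"] refl)
    fix y
    have eq: "(\<integral>\<^sup>+x. indicator {y<..} (R x) * w x \<partial>M) = head w (?m y)"
      unfolding head_def
    proof (rule nn_integral_cong_AE, use R(4) uniform_var_AE_neq[OF U, of "?m y"] in eventually_elim)
      case (elim x)
      have "y < R x \<longleftrightarrow> U x < ?m y" using elim(1) by (rule spec)
      with elim(2) have "y < R x \<longleftrightarrow> U x \<le> ?m y" by linarith
      then show ?case by (auto simp: indicator_def)
    qed
    show "ennreal (?m y) * (ennreal (1 / (if 0 < ?m y then ?m y else 1)) * head w (if 0 < ?m y then ?m y else 1))
        = (\<integral>\<^sup>+x. indicator {y<..} (R x) * w x \<partial>M)"
    proof (cases "0 < ?m y")
      case True
      then have "ennreal (?m y) * ennreal (1 / ?m y) = 1" by (simp flip: ennreal_mult')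
      with True eq show ?thesis by (simp flip: mult.assoc)
    next
      case False
      \<comment> \<open>At these levels the default argument \<open>1\<close> is harmless: the
        weight kills the left side, and the right side vanishes because \<open>U\<close> is positive
        almost everywhere.\<close>
      then have m0: "?m y = 0" using N.cdf_bounded_prob[of y] by simp
      have "AE x in M. indicator {..0} (U x) * w x = 0"
        using uniform_var_AE_Ioo[OF U] by eventually_elim (auto simp: indicator_def)
      then have "head w 0 = 0" unfolding head_def by (simp add: nn_integral_0_iff_AE)
      with eq m0 show ?thesis by simp
    qed
  qed
  also have "\<dots> = (\<integral>\<^sup>+x. ennreal (R x) * w x \<partial>M)"
    by (rule nn_integral_layer_cake[symmetric]) measurable
  finally show ?thesis by (simp add: R_def)
qed

text \<open>Both sides equal \<open>EQ M R X\<close> for the density \<open>R\<close> antimonotone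
  to \<open>X\<close>. Although \<open>R\<close> depends on \<open>X\<close>, the mixing measure
  depends only on the law of \<open>Z\<close>, so one measure serves all \<open>X\<close>.\<close>

lemma (in prob_space) u_mu_mixing_measure:
  assumes atomless: "atomless M" and Z: "Z \<in> densities M" and X[measurable]: "X \<in> borel_measurable M"
  shows "u_mu M (mixing_measure (distr M borel Z)) X
    = (INF Z'\<in>{Z' \<in> borel_measurable M. distr M borel Z' = distr M borel Z}. EQ M Z' X)"
proof -
  obtain U where order: "uniform_var M U" "\<And>t. AE x in M. X x \<le> t \<longleftrightarrow> U x \<le> cdf (distr M borel X) t"
    using atomless_uniform_order[OF atomless X] by blast
  interpret uniform_order M U X by standard (use order in auto)
  define R where "R = (\<lambda>x. quantile (distr M borel Z) (1 - U x))"
  note R = rearranged_density[OF order(1) Z X order(2) R_def]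
  have inf: "(INF Z'\<in>{Z' \<in> borel_measurable M. distr M borel Z' = distr M borel Z}. EQ M Z' X) = EQ M R X"
  proof (rule antisym)
    show "(INF Z'\<in>{Z' \<in> borel_measurable M. distr M borel Z' = distr M borel Z}. EQ M Z' X) \<le> EQ M R X"
      using R by (intro INF_lower) auto
    show "EQ M R X \<le> (INF Z'\<in>{Z' \<in> borel_measurable M. distr M borel Z' = distr M borel Z}. EQ M Z' X)"
      using R(5) X by (intro INF_greatest) auto
  qed
  define \<mu> where "\<mu> = mixing_measure (distr M borel Z)"
  have \<mu>: "prob_on_unit \<mu>" unfolding \<mu>_def by (rule prob_on_unit_mixing_measure[OF Z])
  then have sets: "sets \<mu> = sets (restrict_space borel {0<..1})" by (simp add: prob_on_unit_def)
  have space: "space \<mu> = {0<..1}" using sets_eq_imp_space_eq[OF sets] by (simp add: space_restrict_space)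
  have borel: "h \<in> borel_measurable borel \<Longrightarrow> h \<in> borel_measurable \<mu>" for h :: "real \<Rightarrow> ennreal"
    using measurable_restrict_space1[of h borel borel "{0<..1}"] measurable_cong_sets[OF sets refl] by blast
  define f where "f = (\<lambda>l. ennreal (1 / l) * head (\<lambda>x. ennreal (max (X x) 0)) l)"
  define g where "g = (\<lambda>l. ennreal (1 / l) * head (\<lambda>x. ennreal (max (- X x) 0)) l)"
  have fg: "f \<in> borel_measurable \<mu>" "g \<in> borel_measurable \<mu>"
    unfolding f_def g_def by (auto intro!: borel)
  have "u_mu M \<mu> X = ediff (\<integral>\<^sup>+l. e2ennreal (ediff (f l) (g l)) \<partial>\<mu>) (\<integral>\<^sup>+l. e2ennreal (- ediff (f l) (g l)) \<partial>\<mu>)"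
    unfolding u_mu_def f_def g_def
    by (intro arg_cong2[where f = ediff] nn_integral_cong) (auto simp: u_lambda_eq space)
  \<comment> \<open>\<open>u_mu\<close> separates signs after averaging over the tail,
    \<open>EQ\<close> separates the signs of \<open>X\<close> itself. The two agree because an
    infinite integral of \<open>g\<close> survives the cancellation.\<close>
  also have "\<dots> = ediff (\<integral>\<^sup>+l. f l \<partial>\<mu>) (\<integral>\<^sup>+l. g l \<partial>\<mu>)"
    using u_lambda_negative_part_infinite[OF \<mu> f_def g_def] by (intro ediff_nn_integral[symmetric] fg) auto
  also have "\<dots> = EQ M R X"
    unfolding f_def g_def \<mu>_def EQ_def R_def by (simp add: nn_integral_mixing_measure_head[OF Z])
  finally show ?thesis by (simp add: inf \<mu>_def)
qed

section \<open>Law invariance of Weighted V@R and the equivalences\<close>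

text \<open>Being a density bounded by \<open>1 / l\<close> is a property of the law alone, so the
  defining set is law invariant.\<close>

lemma (in prob_space) law_invariant_u_lambda:
  assumes atomless: "atomless M"
  shows "law_invariant_utility M (u_lambda M l)"
proof (rule law_invariant_INF[OF atomless])
  show "law_invariant_set M {Z \<in> densities M. AE x in M. Z x \<le> 1 / l}"
    unfolding law_invariant_set_def
  proof (intro ballI impI)
    fix Z Z' assume Z: "Z \<in> {Z \<in> densities M. AE x in M. Z x \<le> 1 / l}"
      and Z'[measurable]: "Z' \<in> borel_measurable M" and eq: "distr M borel Z' = distr M borel Z"
    have Zd: "Z \<in> densities M" using Z by simp
    note [measurable] = densities_measurable[OF Zd]
    have "(AE x in M. Z' x \<le> 1 / l) \<longleftrightarrow> (AE y in distr M borel Z'. y \<le> 1 / l)"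
      by (subst AE_distr_iff) auto
    also have "\<dots> \<longleftrightarrow> (AE x in M. Z x \<le> 1 / l)"
      unfolding eq by (subst AE_distr_iff) auto
    finally show "Z' \<in> {Z \<in> densities M. AE x in M. Z x \<le> 1 / l}"
      using Z densities_distr_cong[OF Zd Z' eq] by simp
  qed
qed (auto simp: u_lambda_def)

lemma (in prob_space) law_invariant_u_mu:
  assumes atomless: "atomless M"
  shows "law_invariant_utility M (u_mu M \<mu>)"
  unfolding law_invariant_utility_def
proof (intro ballI impI)
  fix X X' :: "'a \<Rightarrow> real"
  assume "X \<in> borel_measurable M" "X' \<in> borel_measurable M" "distr M borel X = distr M borel X'"
  then have "u_lambda M l X = u_lambda M l X'" for l
    using law_invariant_u_lambda[OF atomless, of l] unfolding law_invariant_utility_def by blast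
  then show "u_mu M \<mu> X = u_mu M \<mu> X'" by (simp add: u_mu_def)
qed

text \<open>The determining set contains every representing set, and its further elements lie above
  \<open>u\<close> by definition, so enlarging to it leaves the infimum unchanged.\<close>

lemma coherent_utility_eq_INF:
  assumes "coherent_utility M u" "X \<in> borel_measurable M"
  shows "u X = (INF Z\<in>determining_set M u. EQ M Z X)"
proof -
  obtain D where D: "D \<subseteq> densities M" "\<forall>X \<in> borel_measurable M. u X = (INF Z\<in>D. EQ M Z X)"
    using assms(1) unfolding coherent_utility_def by blast
  then have "D \<subseteq> determining_set M u"
    by (auto simp: determining_set_def intro: INF_lower)
  then have "(INF Z\<in>determining_set M u. EQ M Z X) \<le> u X"
    using D assms(2) by (auto intro: INF_superset_mono)
  moreover have "u X \<le> (INF Z\<in>determining_set M u. EQ M Z X)"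
    using assms(2) by (intro INF_greatest) (auto simp: determining_set_def)
  ultimately show ?thesis by (rule order_antisym[rotated])
qed

theorem theoremA1:
  fixes M :: "'a measure" and u :: "('a \<Rightarrow> real) \<Rightarrow> ereal"
  assumes "prob_space M"
    and "atomless M"
    and "coherent_utility M u"
  shows "(law_invariant_utility M u \<longleftrightarrow> law_invariant_set M (determining_set M u))
       \<and> (law_invariant_set M (determining_set M u) \<longleftrightarrow>
            (\<exists>\<MM>. (\<forall>\<mu>\<in>\<MM>. prob_on_unit \<mu>) \<and>
                 (\<forall>X \<in> borel_measurable M. u X = (INF \<mu>\<in>\<MM>. u_mu M \<mu> X))))
       \<and> ((\<exists>\<MM>. (\<forall>\<mu>\<in>\<MM>. prob_on_unit \<mu>) \<and>
                 (\<forall>X \<in> borel_measurable M. u X = (INF \<mu>\<in>\<MM>. u_mu M \<mu> X)))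
            \<longleftrightarrow>
           (\<exists>\<MM>. (\<forall>\<mu>\<in>\<MM>. prob_on_unit \<mu>) \<and>
                 determining_set M u = (\<Union>\<mu>\<in>\<MM>. determining_set M (u_mu M \<mu>))))"
    (is "(?i \<longleftrightarrow> ?ii) \<and> (?ii \<longleftrightarrow> ?iii) \<and> (?iii \<longleftrightarrow> ?iv)")
proof -
  interpret prob_space M by fact
  note atomless = \<open>atomless M\<close>
  define D where "D = determining_set M u"
  have D: "D \<subseteq> densities M" by (auto simp: D_def determining_set_def)
  have u_eq: "u X = (INF Z\<in>D. EQ M Z X)" if "X \<in> borel_measurable M" for X
    unfolding D_def by (rule coherent_utility_eq_INF[OF assms(3) that])
  have i_ii: ?ii if ?i by (rule law_invariant_determining_set[OF atomless that])
  have ii_i: ?i if ?ii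
    using that D u_eq unfolding D_def[symmetric] by (rule law_invariant_INF[OF atomless])
  have iii_i: ?i if iii: ?iii
  proof -
    obtain \<MM> where \<MM>: "\<forall>X \<in> borel_measurable M. u X = (INF \<mu>\<in>\<MM>. u_mu M \<mu> X)"
      using iii by (elim exE conjE)
    show ?thesis
      unfolding law_invariant_utility_def
    proof (intro ballI impI)
      fix X X' :: "'a \<Rightarrow> real"
      assume X: "X \<in> borel_measurable M" "X' \<in> borel_measurable M" "distr M borel X = distr M borel X'"
      then have "u_mu M \<mu> X = u_mu M \<mu> X'" for \<mu>
        using law_invariant_u_mu[OF atomless, of \<mu>] unfolding law_invariant_utility_def by blast
      then show "u X = u X'" using \<MM> X by simp
    qed
  qed
  have iv_ii: ?ii if iv: ?iv
  proof -
    obtain \<MM> where eq: "determining_set M u = (\<Union>\<mu>\<in>\<MM>. determining_set M (u_mu M \<mu>))"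
      using iv by blast
    \<comment> \<open>The passage from a law invariant utility to its determining set is applied to
      each \<open>u_mu M \<mu>\<close>; unions preserve law invariance of sets.\<close>
    have "law_invariant_set M (determining_set M (u_mu M \<mu>))" for \<mu>
      by (intro law_invariant_determining_set law_invariant_u_mu atomless)
    then show ?thesis
      unfolding eq law_invariant_set_def by (simp only: UN_iff) blast
  qed
  have "?iii \<and> ?iv" if ii: ?ii
  proof -
    \<comment> \<open>One family serves both representations: each \<open>Z\<close> in
      \<open>D\<close> contributes the mixing measure of its law.\<close>
    define \<MM> where "\<MM> = (\<lambda>Z. mixing_measure (distr M borel Z)) ` D"
    have prob: "\<forall>\<mu>\<in>\<MM>. prob_on_unit \<mu>"
      using D prob_on_unit_mixing_measure by (auto simp: \<MM>_def)
    have iii: "u X = (INF \<mu>\<in>\<MM>. u_mu M \<mu> X)" if X: "X \<in> borel_measurable M" for X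
    proof (rule antisym)
      show "u X \<le> (INF \<mu>\<in>\<MM>. u_mu M \<mu> X)"
      proof (rule INF_greatest)
        fix \<mu> assume "\<mu> \<in> \<MM>"
        then obtain Z where Z: "Z \<in> D" "\<mu> = mixing_measure (distr M borel Z)" by (auto simp: \<MM>_def)
        \<comment> \<open>The utility of the mixing measure is an infimum over the law class of
          \<open>Z\<close>. Law invariance keeps this class inside \<open>D\<close>, so the infimum
          cannot fall below \<open>u X\<close>.\<close>
        have "{Z' \<in> borel_measurable M. distr M borel Z' = distr M borel Z} \<subseteq> D"
          using ii Z(1) unfolding D_def[symmetric] law_invariant_set_def by blast
        then show "u X \<le> u_mu M \<mu> X"
          unfolding Z(2) u_eq[OF X] using Z(1) D X
          by (subst u_mu_mixing_measure[OF atomless]) (auto intro: INF_superset_mono)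
      qed
      show "(INF \<mu>\<in>\<MM>. u_mu M \<mu> X) \<le> u X"
        unfolding u_eq[OF X]
      proof (rule INF_mono)
        fix Z assume Z: "Z \<in> D"
        then have "u_mu M (mixing_measure (distr M borel Z)) X \<le> EQ M Z X"
          using D densities_measurable X
          by (subst u_mu_mixing_measure[OF atomless]) (auto intro!: INF_lower)
        with Z show "\<exists>\<mu>\<in>\<MM>. u_mu M \<mu> X \<le> EQ M Z X" by (auto simp: \<MM>_def)
      qed
    qed
    have "D = (\<Union>\<mu>\<in>\<MM>. determining_set M (u_mu M \<mu>))"
    proof (intro equalityI subsetI)
      fix Z assume Z: "Z \<in> D"
      have "u_mu M (mixing_measure (distr M borel Z)) X \<le> EQ M Z X" if X: "X \<in> borel_measurable M" for X
        using D Z densities_measurable X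
        by (subst u_mu_mixing_measure[OF atomless]) (auto intro!: INF_lower)
      then have "Z \<in> determining_set M (u_mu M (mixing_measure (distr M borel Z)))"
        using Z D by (auto simp: determining_set_def)
      with Z show "Z \<in> (\<Union>\<mu>\<in>\<MM>. determining_set M (u_mu M \<mu>))" by (auto simp: \<MM>_def)
    next
      fix Z assume "Z \<in> (\<Union>\<mu>\<in>\<MM>. determining_set M (u_mu M \<mu>))"
      then obtain \<mu> where \<mu>: "\<mu> \<in> \<MM>" "Z \<in> determining_set M (u_mu M \<mu>)" by blast
      have "u X \<le> EQ M Z X" if X: "X \<in> borel_measurable M" for X
      proof -
        have "u X \<le> u_mu M \<mu> X" unfolding iii[OF X] using \<mu>(1) by (rule INF_lower)
        also have "\<dots> \<le> EQ M Z X" using \<mu>(2) X by (simp add: determining_set_def)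
        finally show ?thesis .
      qed
      then show "Z \<in> D" using \<mu>(2) by (auto simp: D_def determining_set_def)
    qed
    with prob iii show ?thesis unfolding D_def by blast
  qed
  with i_ii ii_i iii_i iv_ii show ?thesis by blast
qed

end
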